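(* Let $R$ be a real closed field. The Krull dimension of the ring $R_b(R^n)$ of locally bounded rational functions on $R^n$ is $n$.
   Context: A rational function on $R^n$ is a quotient $f=p/q$ of polynomials in $n$ variables over $R$ with $q\neq 0$; $\mathrm{dom}(f)$ is the largest dense Zariski open subset of $R^n$ on which $f$ is regular (given as a quotient of polynomials with nowhere vanishing denominator, hence $R$-valued). $f$ is locally bounded if every $x\in R^n$ has a neighbourhood $V_x$ in the euclidean topology (induced by the order of $R$) such that $f(V_x\cap\mathrm{dom}(f))$ is a bounded subset of $R$. $R_b(R^n)$ is the set of all locally bounded rational functions on $R^n$, which is a subring of the field of rational functions. *)

theory Defs
  imports
    "HOL-Analysis.Analysis"
    "HOL-Library.Poly_Mapping"
    "HOL-Computational_Algebra.Fraction_Field"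
    "HOL-Algebra.Algebraic_Closure_Type"
begin

text \<open>The order of a real closed field is determined by the field structure, so nothing is lost by
  making it part of the class. Polynomials are given by their coefficient functions, as in the
  library class \<open>alg_closed_field\<close>.\<close>

class real_closed_field = linordered_field +
  assumes nonneg_is_square: "0 \<le> a \<Longrightarrow> \<exists>x. x * x = a"
    and odd_degree_root: "odd n \<Longrightarrow> f n \<noteq> 0 \<Longrightarrow> \<exists>x. (\<Sum>k\<le>n. f k * x ^ k) = 0"

text \<open>Polynomials over \<open>'r\<close> in countably many variables: a monomial is a finitely supported exponent
  vector, and the outer finitely supported map gives the coefficients. \<open>polys n\<close> is the subring
  of those that involve only the variables \<open>0, \<dots>, n - 1\<close>, and \<open>ratfuns n\<close> is its field of
  fractions, as a subfield of the field of fractions of the whole ring.\<close>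

type_synonym 'r mpolynomial = "(nat \<Rightarrow>\<^sub>0 nat) \<Rightarrow>\<^sub>0 'r"
type_synonym 'r ratfun = "'r mpolynomial fract"

definition polys :: "nat \<Rightarrow> 'r::zero mpolynomial set" where
  "polys n = {p. \<forall>m \<in> Poly_Mapping.keys p. Poly_Mapping.keys m \<subseteq> {..<n}}"

definition ratfuns :: "nat \<Rightarrow> 'r::linordered_field ratfun set" where
  "ratfuns n = {Fract p q | p q. p \<in> polys n \<and> q \<in> polys n \<and> q \<noteq> 0}"

definition poly_eval :: "(nat \<Rightarrow> 'r) \<Rightarrow> 'r::comm_semiring_1 mpolynomial \<Rightarrow> 'r" where
  "poly_eval x p = (\<Sum>m \<in> Poly_Mapping.keys p.
     Poly_Mapping.lookup p m * (\<Prod>i \<in> Poly_Mapping.keys m. x i ^ Poly_Mapping.lookup m i))"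

text \<open>Points of \<open>R\<^sup>n\<close> are the functions on \<open>{..<n}\<close>, extended by \<open>undefined\<close>, so that the topology
  of \<open>R\<^sup>n\<close> is a library product topology.\<close>

definition affine_space :: "nat \<Rightarrow> (nat \<Rightarrow> 'r) set" where
  "affine_space n = {..<n} \<rightarrow>\<^sub>E UNIV"

definition order_topology_of :: "'r::linorder topology" where
  "order_topology_of = topology_generated_by ({{..<a} | a. True} \<union> {{a<..} | a. True})"

definition euclidean_topology :: "nat \<Rightarrow> (nat \<Rightarrow> 'r::linorder) topology" where
  "euclidean_topology n = product_topology (\<lambda>_. order_topology_of) {..<n}"

definition zariski_open :: "nat \<Rightarrow> (nat \<Rightarrow> 'r::linordered_field) set \<Rightarrow> bool" where
  "zariski_open n U \<longleftrightarrow> (\<exists>S \<subseteq> polys n. U = {x \<in> affine_space n. \<exists>p \<in> S. poly_eval x p \<noteq> 0})"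

definition zariski_dense :: "nat \<Rightarrow> (nat \<Rightarrow> 'r::linordered_field) set \<Rightarrow> bool" where
  "zariski_dense n U \<longleftrightarrow> (\<forall>W. zariski_open n W \<and> W \<noteq> {} \<longrightarrow> U \<inter> W \<noteq> {})"

definition regular_on :: "nat \<Rightarrow> 'r::linordered_field ratfun \<Rightarrow> (nat \<Rightarrow> 'r) set \<Rightarrow> bool" where
  "regular_on n f U \<longleftrightarrow>
     (\<exists>p \<in> polys n. \<exists>q \<in> polys n. q \<noteq> 0 \<and> f = Fract p q \<and> (\<forall>x \<in> U. poly_eval x q \<noteq> 0))"

text \<open>The largest dense Zariski open set on which \<open>f\<close> is regular, as the union of all of them.
  The union is again such a set: if \<open>f = p / q\<close> in lowest terms, every other denominator of \<open>f\<close>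
  is a multiple of \<open>q\<close>, so the union is the set where \<open>q\<close> does not vanish.\<close>

definition ratfun_dom :: "nat \<Rightarrow> 'r::linordered_field ratfun \<Rightarrow> (nat \<Rightarrow> 'r) set" where
  "ratfun_dom n f = \<Union>{U. zariski_open n U \<and> zariski_dense n U \<and> regular_on n f U}"

text \<open>The value at a point of the domain does not depend on the chosen quotient, see
  \<open>ratfun_value_Fract\<close> below. Outside the domain it is unspecified.\<close>

definition ratfun_value :: "nat \<Rightarrow> 'r::linordered_field ratfun \<Rightarrow> (nat \<Rightarrow> 'r) \<Rightarrow> 'r" where
  "ratfun_value n f x = (THE v. \<exists>p \<in> polys n. \<exists>q \<in> polys n.
     f = Fract p q \<and> poly_eval x q \<noteq> 0 \<and> v = poly_eval x p / poly_eval x q)"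

definition bounded_subset :: "'r::linordered_field set \<Rightarrow> bool" where
  "bounded_subset B \<longleftrightarrow> (\<exists>c. \<forall>y \<in> B. \<bar>y\<bar> \<le> c)"

definition locally_bounded :: "nat \<Rightarrow> 'r::linordered_field ratfun \<Rightarrow> bool" where
  "locally_bounded n f \<longleftrightarrow>
     (\<forall>x \<in> affine_space n. \<exists>V. openin (euclidean_topology n) V \<and> x \<in> V \<and>
        bounded_subset (ratfun_value n f ` (V \<inter> ratfun_dom n f)))"

definition locally_bounded_ring :: "nat \<Rightarrow> 'r::linordered_field ratfun ring" where
  "locally_bounded_ring n =
     ring_of_type_algebra\<lparr>carrier := {f \<in> ratfuns n. locally_bounded n f}\<rparr>"

text \<open>The supremum of the lengths of chains of prime ideals. The extended reals are used so that
  a structure without prime ideals (such as the zero ring) has dimension \<open>- \<infinity>\<close>.\<close>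

definition krull_dim :: "('a, 'b) ring_scheme \<Rightarrow> ereal" where
  "krull_dim A = (SUP m \<in> {m. \<exists>P. (\<forall>i\<le>m. primeideal (P i) A) \<and> (\<forall>i<m. P i \<subset> P (Suc i))}.
     ereal (real m))"


lemma topspace_order_topology_of:
  "topspace (order_topology_of :: 'r::linordered_field topology) = UNIV"
proof -
  have "\<exists>a. x < a" for x :: 'r
    by (rule gt_ex)
  then show ?thesis
    unfolding order_topology_of_def topology_generated_by_topspace by blast
qed

lemma topspace_euclidean_topology:
  "topspace (euclidean_topology n :: (nat \<Rightarrow> 'r::linordered_field) topology) = affine_space n"
  by (simp add: euclidean_topology_def affine_space_def topspace_order_topology_of)

abbreviation monom_eval :: "(nat \<Rightarrow> 'r) \<Rightarrow> (nat \<Rightarrow>\<^sub>0 nat) \<Rightarrow> 'r::comm_semiring_1" where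
  "monom_eval x m \<equiv> \<Prod>i \<in> Poly_Mapping.keys m. x i ^ Poly_Mapping.lookup m i"

lemma monom_eval_superset:
  assumes "finite A" "Poly_Mapping.keys m \<subseteq> A"
  shows "monom_eval x m = (\<Prod>i \<in> A. x i ^ Poly_Mapping.lookup m i)"
  using assms by (intro prod.mono_neutral_left) (auto simp: in_keys_iff)

lemma monom_eval_add: "monom_eval x (a + b) = monom_eval x a * monom_eval x b"
proof -
  let ?A = "Poly_Mapping.keys a \<union> Poly_Mapping.keys b"
  have "monom_eval x (a + b) = (\<Prod>i \<in> ?A. x i ^ Poly_Mapping.lookup (a + b) i)"
    by (intro monom_eval_superset) (simp_all add: Poly_Mapping.keys_add)
  also have "\<dots> = (\<Prod>i \<in> ?A. x i ^ Poly_Mapping.lookup a i) * (\<Prod>i \<in> ?A. x i ^ Poly_Mapping.lookup b i)"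
    by (simp add: lookup_add power_add prod.distrib)
  also have "\<dots> = monom_eval x a * monom_eval x b"
    by (simp add: monom_eval_superset[of ?A a] monom_eval_superset[of ?A b])
  finally show ?thesis .
qed

lemma poly_eval_superset:
  assumes "finite A" "Poly_Mapping.keys p \<subseteq> A"
  shows "poly_eval x p = (\<Sum>m \<in> A. Poly_Mapping.lookup p m * monom_eval x m)"
  unfolding poly_eval_def using assms
  by (intro sum.mono_neutral_left) (auto simp: in_keys_iff)

lemma poly_eval_add: "poly_eval x (p + q) = poly_eval x p + poly_eval x q"
proof -
  let ?A = "Poly_Mapping.keys p \<union> Poly_Mapping.keys q"
  have "poly_eval x (p + q) = (\<Sum>m \<in> ?A. Poly_Mapping.lookup (p + q) m * monom_eval x m)"
    by (intro poly_eval_superset) (simp_all add: Poly_Mapping.keys_add)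
  also have "\<dots> = poly_eval x p + poly_eval x q"
    by (simp add: poly_eval_superset[of ?A p] poly_eval_superset[of ?A q]
        lookup_add distrib_right sum.distrib)
  finally show ?thesis .
qed

lemma poly_eval_single: "poly_eval x (Poly_Mapping.single m c) = c * monom_eval x m"
  by (simp add: poly_eval_def)

lemma poly_eval_zero [simp]: "poly_eval x 0 = 0"
  by (simp add: poly_eval_def)

lemma poly_mapping_sum_single: "p = (\<Sum>m \<in> Poly_Mapping.keys p. Poly_Mapping.single m (Poly_Mapping.lookup p m))"
  by (rule poly_mapping_eqI)
     (auto simp: lookup_sum lookup_single when_def in_keys_iff)

lemma poly_eval_sum: "poly_eval x (sum f A) = (\<Sum>a \<in> A. poly_eval x (f a))"
  by (induction A rule: infinite_finite_induct) (auto simp: poly_eval_add)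

lemma poly_eval_mult: "poly_eval x (p * q) = poly_eval x p * poly_eval x q"
proof -
  have "p * q = (\<Sum>m \<in> Poly_Mapping.keys p. \<Sum>l \<in> Poly_Mapping.keys q.
      Poly_Mapping.single (m + l) (Poly_Mapping.lookup p m * Poly_Mapping.lookup q l))"
    by (subst (1) poly_mapping_sum_single[of p], subst (1) poly_mapping_sum_single[of q])
       (simp only: sum_product mult_single)
  then have "poly_eval x (p * q) = (\<Sum>m \<in> Poly_Mapping.keys p. \<Sum>l \<in> Poly_Mapping.keys q.
      (Poly_Mapping.lookup p m * Poly_Mapping.lookup q l) * (monom_eval x m * monom_eval x l))"
    by (simp only: poly_eval_sum poly_eval_single monom_eval_add)
  also have "\<dots> = poly_eval x p * poly_eval x q"
    by (simp add: poly_eval_def sum_product mult_ac)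
  finally show ?thesis .
qed

lemma ratfun_value_Fract:
  assumes "p \<in> polys n" "q \<in> polys n" "poly_eval x q \<noteq> 0"
  shows "ratfun_value n (Fract p q) x = poly_eval x p / poly_eval x q"
  unfolding ratfun_value_def
proof (rule the_equality)
  show "\<exists>p' \<in> polys n. \<exists>q' \<in> polys n. Fract p q = Fract p' q' \<and> poly_eval x q' \<noteq> 0 \<and>
      poly_eval x p / poly_eval x q = poly_eval x p' / poly_eval x q'"
    using assms by blast
next
  fix v
  assume "\<exists>p' \<in> polys n. \<exists>q' \<in> polys n. Fract p q = Fract p' q' \<and> poly_eval x q' \<noteq> 0 \<and>
      v = poly_eval x p' / poly_eval x q'"
  then obtain p' q' where *: "Fract p q = Fract p' q'" "poly_eval x q' \<noteq> 0"
    "v = poly_eval x p' / poly_eval x q'" by blast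
  have "q \<noteq> 0" "q' \<noteq> 0"
    using assms(3) *(2) by auto
  then have "p * q' = p' * q"
    using *(1) by (simp add: eq_fract)
  then have "poly_eval x p * poly_eval x q' = poly_eval x p' * poly_eval x q"
    by (metis poly_eval_mult)
  then show "v = poly_eval x p / poly_eval x q"
    using assms(3) *(2,3) by (simp add: frac_eq_eq)
qed

end

theory Submission
  imports Defs
begin

text \<open>
  The upper bound holds because the ring consists of rational functions in \<open>n\<close> variables and
  contains the constants. Given primes \<open>P 0 \<subset> \<dots> \<subset> P m\<close>, elements
  \<open>a i \<in> P (Suc i) - P i\<close> are algebraically independent over the base field
  (\<open>prime_chain_independent\<close>), and counting monomials of bounded degree shows that rational
  functions in \<open>n\<close> variables admit at most \<open>n\<close> algebraically independent elements
  (\<open>algebraically_independent_le\<close>).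

  For the lower bound, the lexicographic valuation sends \<open>p / q\<close> to the difference of the
  lexicographically smallest exponent vectors of \<open>p\<close> and \<open>q\<close>. Its valuation ring has a
  chain of \<open>n + 1\<close> primes: the \<open>k\<close>-th one asks that the first \<open>k\<close> entries of the
  value be lexicographically positive. A locally bounded function lies in this valuation ring
  (\<open>locally_bounded_imp_lowest_monomial_le\<close>): otherwise it would be unbounded along a suitable
  curve \<open>t \<mapsto> (t\<^bsup>w 0\<^esup>, \<dots>, t\<^bsup>w (n - 1)\<^esup>)\<close> that
  tends to the origin. So the primes can be intersected with the ring of locally bounded functions,
  and the intersections remain distinct because the polynomial \<open>x\<^sub>k\<close> is locally bounded
  and lies in the intersection number \<open>k + 1\<close> but not in number \<open>k\<close>
  (\<open>lex_prime_strict_chain\<close>).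

  Both the ring structure and the comparison with the valuation use that \<open>p / q\<close> is locally
  bounded if and only if every point has a neighbourhood on which
  \<open>\<bar>p\<bar> \<le> c * \<bar>q\<bar>\<close> for some constant \<open>c\<close>
  (\<open>locally_bounded_Fract_iff\<close>).
\<close>

section \<open>Polynomials in one variable near zero\<close>

lemma poly_bounded_near_0:
  fixes G :: "'a::linordered_field poly"
  shows "\<exists>B. \<forall>t. \<bar>t\<bar> \<le> 1 \<longrightarrow> \<bar>poly G t\<bar> \<le> B"
proof (induction G)
  case 0
  show ?case by (intro exI[of _ 0]) simp
next
  case (pCons a G)
  then obtain B where B: "\<And>t. \<bar>t\<bar> \<le> 1 \<Longrightarrow> \<bar>poly G t\<bar> \<le> B" by blast
  have "\<bar>a + t * poly G t\<bar> \<le> \<bar>a\<bar> + B" if "\<bar>t\<bar> \<le> 1" for t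
  proof -
    have "\<bar>t * poly G t\<bar> \<le> 1 * B"
      unfolding abs_mult using that B[OF that] by (intro mult_mono) auto
    then show ?thesis using abs_triangle_ineq[of a "t * poly G t"] by linarith
  qed
  then show ?case by (intro exI[of _ "\<bar>a\<bar> + B"]) simp
qed

lemma poly_pos_near_0:
  fixes G :: "'a::linordered_field poly"
  assumes "poly G 0 > 0"
  obtains d where "d > 0" "\<And>t. 0 < t \<Longrightarrow> t < d \<Longrightarrow> poly G t > 0"
proof -
  obtain a H where G: "G = pCons a H" by (cases G)
  with assms have a: "a > 0" by simp
  obtain B where B: "\<And>t. \<bar>t\<bar> \<le> 1 \<Longrightarrow> \<bar>poly H t\<bar> \<le> B"
    using poly_bounded_near_0[of H] by blast
  have "B \<ge> 0" using B[of 0] by simp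
  show ?thesis
  proof (rule that[of "min 1 (a / (B + 1))"])
    show "min 1 (a / (B + 1)) > 0" using a \<open>B \<ge> 0\<close> by simp
    fix t :: 'a
    assume t: "0 < t" "t < min 1 (a / (B + 1))"
    have "t * (B + 1) < a" using t \<open>B \<ge> 0\<close> by (simp add: pos_less_divide_eq)
    moreover have "\<bar>t * poly H t\<bar> \<le> t * B"
      unfolding abs_mult using t B[of t] by (simp add: mult_left_mono)
    ultimately show "poly G t > 0" unfolding G using t by (simp add: algebra_simps abs_le_iff)
  qed
qed

lemma poly_nonzero_near_0:
  fixes G :: "'a::linordered_field poly"
  assumes "G \<noteq> 0"
  obtains d where "d > 0" "\<And>t. 0 < t \<Longrightarrow> t < d \<Longrightarrow> poly G t \<noteq> 0"
proof -
  let ?Z = "insert 1 {t. t > 0 \<and> poly G t = 0}"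
  have fin: "finite ?Z"
    using finite_subset[OF _ poly_roots_finite[OF assms], of "{t. t > 0 \<and> poly G t = 0}"] by auto
  show ?thesis
  proof (rule that[of "Min ?Z"])
    show "Min ?Z > 0" using fin by (subst Min_gr_iff) auto
    fix t :: 'a
    assume t: "0 < t" "t < Min ?Z"
    show "poly G t \<noteq> 0"
    proof
      assume "poly G t = 0"
      then have "Min ?Z \<le> t" using t fin by (intro Min_le) auto
      with t show False by simp
    qed
  qed
qed

text \<open>Continuity at \<open>0\<close>, obtained from signs alone so that it holds over every ordered
  field: comparing squares turns the inequality into the sign of one polynomial, and a polynomial
  that is positive at \<open>0\<close> stays positive nearby.\<close>

lemma poly_bound_at_0:
  fixes G H :: "'a::linordered_field poly"
  assumes "c \<ge> 0" "d > 0"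
    and le: "\<And>t. 0 < t \<Longrightarrow> t < d \<Longrightarrow> \<bar>poly G t\<bar> \<le> c * \<bar>poly H t\<bar>"
  shows "\<bar>poly G 0\<bar> \<le> c * \<bar>poly H 0\<bar>"
proof (rule ccontr)
  let ?D = "G * G - Polynomial.smult (c * c) (H * H)"
  have D: "poly ?D t = \<bar>poly G t\<bar> * \<bar>poly G t\<bar> - (c * \<bar>poly H t\<bar>) * (c * \<bar>poly H t\<bar>)" for t
    by (simp add: mult_ac)
  assume "\<not> ?thesis"
  then have "(c * \<bar>poly H 0\<bar>) * (c * \<bar>poly H 0\<bar>) < \<bar>poly G 0\<bar> * \<bar>poly G 0\<bar>"
    using \<open>c \<ge> 0\<close> by (intro mult_strict_mono') auto
  then have "poly ?D 0 > 0" unfolding D by simp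
  then obtain d' where d': "d' > 0" "\<And>t. 0 < t \<Longrightarrow> t < d' \<Longrightarrow> poly ?D t > 0"
    by (rule poly_pos_near_0) blast
  obtain t where t: "0 < t" "t < min d d'"
    using dense[of 0 "min d d'"] d'(1) \<open>d > 0\<close> by auto
  have "\<bar>poly G t\<bar> * \<bar>poly G t\<bar> \<le> (c * \<bar>poly H t\<bar>) * (c * \<bar>poly H t\<bar>)"
    using le[of t] t \<open>c \<ge> 0\<close> by (intro mult_mono) auto
  moreover have "poly ?D t > 0" using d'(2) t by simp
  ultimately show False unfolding D by simp
qed

section \<open>Polynomials in several variables\<close>

lemma polys_zero: "0 \<in> polys n"
  by (simp add: polys_def)

lemma polys_single: "Poly_Mapping.keys m \<subseteq> {..<n} \<Longrightarrow> Poly_Mapping.single m c \<in> polys n"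
  by (simp add: polys_def)

lemma polys_one: "(1 :: 'r::comm_ring_1 mpolynomial) \<in> polys n"
  by (metis polys_single single_one keys_zero empty_subsetI)

lemma polys_add: "p \<in> polys n \<Longrightarrow> q \<in> polys n \<Longrightarrow> p + q \<in> polys n"
  unfolding polys_def using Poly_Mapping.keys_add[of p q] by blast

lemma keys_mult_imp:
  assumes "m \<in> Poly_Mapping.keys (p * q :: 'r::comm_ring_1 mpolynomial)"
  obtains a b where "m = a + b" "a \<in> Poly_Mapping.keys p" "b \<in> Poly_Mapping.keys q"
  using assms keys_mult[of p q] by blast

lemma polys_mult:
  fixes p q :: "'r::comm_ring_1 mpolynomial"
  assumes "p \<in> polys n" "q \<in> polys n"
  shows "p * q \<in> polys n"
  unfolding polys_def
proof (intro CollectI ballI)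
  fix m
  assume "m \<in> Poly_Mapping.keys (p * q)"
  then obtain a b where "m = a + b" "a \<in> Poly_Mapping.keys p" "b \<in> Poly_Mapping.keys q"
    by (rule keys_mult_imp)
  then show "Poly_Mapping.keys m \<subseteq> {..<n}"
    using assms Poly_Mapping.keys_add[of a b] unfolding polys_def by blast
qed

lemma poly_eval_one [simp]: "poly_eval x 1 = 1"
  using poly_eval_single[of x 0 1] by simp

lemma poly_eval_cong:
  assumes "p \<in> polys n" "\<And>i. i < n \<Longrightarrow> x i = y i"
  shows "poly_eval x p = poly_eval y p"
proof -
  have "monom_eval x m = monom_eval y m" if "m \<in> Poly_Mapping.keys p" for m
  proof (intro prod.cong refl)
    fix i
    assume "i \<in> Poly_Mapping.keys m"
    then have "i < n" using assms(1) that unfolding polys_def by auto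
    then show "x i ^ Poly_Mapping.lookup m i = y i ^ Poly_Mapping.lookup m i"
      by (simp add: assms(2))
  qed
  then show ?thesis unfolding poly_eval_def by (intro sum.cong) auto
qed

lemma poly_eval_along_curve:
  fixes \<gamma> :: "nat \<Rightarrow> 'r::comm_ring_1 poly"
  shows "\<exists>G. \<forall>t. poly_eval (\<lambda>i. poly (\<gamma> i) t) p = poly G t"
  by (rule exI[of _ "\<Sum>m \<in> Poly_Mapping.keys p. Polynomial.smult (Poly_Mapping.lookup p m)
      (\<Prod>i \<in> Poly_Mapping.keys m. \<gamma> i ^ Poly_Mapping.lookup m i)"])
     (simp add: poly_eval_def poly_sum poly_prod poly_power)

section \<open>Lowest monomials along monomial curves\<close>

definition weight_of :: "nat \<Rightarrow> (nat \<Rightarrow> nat) \<Rightarrow> (nat \<Rightarrow>\<^sub>0 nat) \<Rightarrow> nat" where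
  "weight_of n w m = (\<Sum>i<n. w i * Poly_Mapping.lookup m i)"

text \<open>On finitely many exponent vectors, comparing lexicographically is comparing numbers written
  in a large base \<open>N\<close>. A one-parameter curve
  \<open>t \<mapsto> (t\<^bsup>w 0\<^esup>, t\<^bsup>w 1\<^esup>, \<dots>)\<close> therefore sees the
  lexicographic order, although that order itself has rank \<open>n\<close>. The weights are positive so
  that the curve tends to the origin as \<open>t\<close> tends to \<open>0\<close>.\<close>

lemma weights_refine_lex_order:
  assumes "finite M" and vars: "\<forall>m \<in> M. Poly_Mapping.keys m \<subseteq> {..<n}"
  obtains w where "\<forall>i. w i > 0" "strict_mono_on M (weight_of n w)"
proof -
  define N where "N = Suc (\<Sum>m\<in>M. \<Sum>i<n. Poly_Mapping.lookup m i)"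
  have N: "Poly_Mapping.lookup m i < N" if "m \<in> M" "i < n" for m i
  proof -
    have "Poly_Mapping.lookup m i \<le> (\<Sum>i<n. Poly_Mapping.lookup m i)"
      using that by (intro member_le_sum) auto
    also have "\<dots> \<le> (\<Sum>m\<in>M. \<Sum>i<n. Poly_Mapping.lookup m i)"
      using that \<open>finite M\<close> by (intro member_le_sum) auto
    finally show ?thesis unfolding N_def by simp
  qed
  define w where "w i = N ^ (n - 1 - i)" for i
  \<comment> \<open>The exponents are digits in base \<open>N\<close>: all digits from position \<open>k\<close> on are worth less than one
      unit at position \<open>k - 1\<close>.\<close>
  have tail: "(\<Sum>i=k..<n. w i * Poly_Mapping.lookup m i) < N ^ (n - k)" if "m \<in> M" "k \<le> n" for m k
    using that(2)
  proof (induction rule: inc_induct)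
    case base
    show ?case by simp
  next
    case (step k)
    have "(\<Sum>i=k..<n. w i * Poly_Mapping.lookup m i)
        = w k * Poly_Mapping.lookup m k + (\<Sum>i=Suc k..<n. w i * Poly_Mapping.lookup m i)"
      using step.hyps by (simp add: sum.atLeast_Suc_lessThan)
    also have "\<dots> < w k * Poly_Mapping.lookup m k + N ^ (n - Suc k)"
      using step.IH by simp
    also have "\<dots> = w k * Suc (Poly_Mapping.lookup m k)"
      by (simp add: w_def)
    also have "\<dots> \<le> w k * N"
      using N[OF that(1), of k] step.hyps by (intro mult_le_mono) auto
    also have "\<dots> = N ^ (n - k)"
    proof -
      have "n - k = Suc (n - 1 - k)" using step.hyps by simp
      then show ?thesis by (simp add: w_def)
    qed
    finally show ?case .
  qed
  show ?thesis
  proof (rule that[of w])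
    show "\<forall>i. w i > 0" by (simp add: w_def N_def)
    show "strict_mono_on M (weight_of n w)"
    proof (rule strict_mono_onI)
      fix a b
      assume ab: "a \<in> M" "b \<in> M" "a < b"
      then obtain k where k: "Poly_Mapping.lookup a k < Poly_Mapping.lookup b k"
        and eq: "\<And>i. i < k \<Longrightarrow> Poly_Mapping.lookup a i = Poly_Mapping.lookup b i"
        by (auto simp: less_poly_mapping.rep_eq less_fun_def)
      have "k \<in> Poly_Mapping.keys b" using k by (simp add: in_keys_iff)
      then have "k < n" using vars ab(2) by auto
      have split: "weight_of n w m = (\<Sum>i<k. w i * Poly_Mapping.lookup m i)
          + w k * Poly_Mapping.lookup m k + (\<Sum>i=Suc k..<n. w i * Poly_Mapping.lookup m i)" for m
      proof -
        have "{..<n} = {..<k} \<union> {k..<n}" using \<open>k < n\<close> by auto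
        then have "weight_of n w m = (\<Sum>i<k. w i * Poly_Mapping.lookup m i)
            + (\<Sum>i=k..<n. w i * Poly_Mapping.lookup m i)"
          unfolding weight_of_def by (simp add: sum.union_disjoint ivl_disj_int)
        then show ?thesis using \<open>k < n\<close> by (simp add: sum.atLeast_Suc_lessThan)
      qed
      have "weight_of n w a < (\<Sum>i<k. w i * Poly_Mapping.lookup a i)
          + w k * Poly_Mapping.lookup a k + N ^ (n - Suc k)"
        unfolding split using tail[OF ab(1), of "Suc k"] \<open>k < n\<close> by simp
      also have "\<dots> = (\<Sum>i<k. w i * Poly_Mapping.lookup b i) + w k * Suc (Poly_Mapping.lookup a k)"
        using eq by (simp add: w_def)
      also have "\<dots> \<le> (\<Sum>i<k. w i * Poly_Mapping.lookup b i) + w k * Poly_Mapping.lookup b k"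
        using k by (intro add_left_mono mult_le_mono) auto
      also have "\<dots> \<le> weight_of n w b" unfolding split by simp
      finally show "weight_of n w a < weight_of n w b" .
    qed
  qed
qed

text \<open>The order on exponent vectors is lexicographic, and variable \<open>0\<close> counts most. The
  lowest monomial dominates near the origin when each variable is infinitesimally small compared
  with all powers of the next one.\<close>

abbreviation lowest_monomial :: "'r::zero mpolynomial \<Rightarrow> nat \<Rightarrow>\<^sub>0 nat" where
  "lowest_monomial p \<equiv> Min (Poly_Mapping.keys p)"

lemma lowest_monomial_in_keys: "p \<noteq> 0 \<Longrightarrow> lowest_monomial p \<in> Poly_Mapping.keys p"
  by (intro Min_in) auto

abbreviation monomial_curve :: "nat \<Rightarrow> (nat \<Rightarrow> nat) \<Rightarrow> 'r::comm_ring_1 \<Rightarrow> nat \<Rightarrow> 'r" where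
  "monomial_curve n w t \<equiv> (\<lambda>i\<in>{..<n}. t ^ w i)"

text \<open>All other monomials have strictly larger weight, so the lowest one can be factored out
  along the curve, and the cofactor tends to its nonzero coefficient.\<close>

lemma poly_eval_monomial_curve:
  fixes p :: "'r::linordered_field mpolynomial"
  assumes p: "p \<in> polys n" "p \<noteq> 0"
    and w: "strict_mono_on (Poly_Mapping.keys p) (weight_of n w)"
  obtains G where "poly G 0 \<noteq> 0"
    "\<forall>t. poly_eval (monomial_curve n w t) p = t ^ weight_of n w (lowest_monomial p) * poly G t"
proof -
  define m0 where "m0 = lowest_monomial p"
  have m0: "m0 \<in> Poly_Mapping.keys p" unfolding m0_def by (rule lowest_monomial_in_keys[OF p(2)])
  have less: "weight_of n w m0 < weight_of n w m" if "m \<in> Poly_Mapping.keys p - {m0}" for m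
  proof -
    have "m0 \<le> m" using that unfolding m0_def by simp
    with that show ?thesis by (intro strict_mono_onD[OF w m0]) auto
  qed
  define H where "H = (\<Sum>m \<in> Poly_Mapping.keys p - {m0}.
    Polynomial.monom (Poly_Mapping.lookup p m) (weight_of n w m - weight_of n w m0 - 1))"
  have monom: "monom_eval (monomial_curve n w t) m = t ^ weight_of n w m"
    if "m \<in> Poly_Mapping.keys p" for m t
  proof -
    have "Poly_Mapping.keys m \<subseteq> {..<n}" using that p(1) by (auto simp: polys_def)
    then have "monom_eval (monomial_curve n w t) m
        = (\<Prod>i<n. monomial_curve n w t i ^ Poly_Mapping.lookup m i)"
      by (intro monom_eval_superset) auto
    also have "\<dots> = (\<Prod>i<n. t ^ (w i * Poly_Mapping.lookup m i))"
      by (intro prod.cong) (auto simp: power_mult)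
    finally show ?thesis by (simp add: weight_of_def power_sum)
  qed
  show ?thesis
  proof (rule that[of "pCons (Poly_Mapping.lookup p m0) H"])
    show "poly (pCons (Poly_Mapping.lookup p m0) H) 0 \<noteq> 0" using m0 by (simp add: in_keys_iff)
    show "\<forall>t. poly_eval (monomial_curve n w t) p
        = t ^ weight_of n w (lowest_monomial p) * poly (pCons (Poly_Mapping.lookup p m0) H) t"
    proof
      fix t
      have "poly_eval (monomial_curve n w t) p
          = (\<Sum>m \<in> Poly_Mapping.keys p. Poly_Mapping.lookup p m * t ^ weight_of n w m)"
        unfolding poly_eval_def by (intro sum.cong refl) (simp only: monom)
      also have "\<dots> = Poly_Mapping.lookup p m0 * t ^ weight_of n w m0
          + (\<Sum>m \<in> Poly_Mapping.keys p - {m0}. Poly_Mapping.lookup p m * t ^ weight_of n w m)"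
        using m0 by (simp add: sum.remove)
      also have "(\<Sum>m \<in> Poly_Mapping.keys p - {m0}. Poly_Mapping.lookup p m * t ^ weight_of n w m)
          = t ^ weight_of n w m0 * (t * poly H t)"
      proof -
        have "Poly_Mapping.lookup p m * t ^ weight_of n w m = t ^ weight_of n w m0 *
            (t * poly (Polynomial.monom (Poly_Mapping.lookup p m) (weight_of n w m - weight_of n w m0 - 1)) t)"
          if "m \<in> Poly_Mapping.keys p - {m0}" for m
        proof -
          have "weight_of n w m = weight_of n w m0 + Suc (weight_of n w m - weight_of n w m0 - 1)"
            using less[OF that] by simp
          then have "t ^ weight_of n w m = t ^ weight_of n w m0 *
              (t * t ^ (weight_of n w m - weight_of n w m0 - 1))"
            by (metis power_add power_Suc)
          then show ?thesis by (simp add: poly_monom mult_ac)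
        qed
        then show ?thesis by (simp add: H_def poly_sum sum_distrib_left)
      qed
      also have "Poly_Mapping.lookup p m0 * t ^ weight_of n w m0 + t ^ weight_of n w m0 * (t * poly H t)
          = t ^ weight_of n w m0 * poly (pCons (Poly_Mapping.lookup p m0) H) t"
        by (simp add: algebra_simps)
      finally show "poly_eval (monomial_curve n w t) p
          = t ^ weight_of n w (lowest_monomial p) * poly (pCons (Poly_Mapping.lookup p m0) H) t"
        unfolding m0_def .
    qed
  qed
qed

lemma poly_nonvanishing_point:
  fixes p :: "'r::linordered_field mpolynomial"
  assumes "p \<in> polys n" "p \<noteq> 0"
  obtains x where "x \<in> affine_space n" "poly_eval x p \<noteq> 0"
proof -
  have "\<forall>m \<in> Poly_Mapping.keys p. Poly_Mapping.keys m \<subseteq> {..<n}"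
    using assms(1) by (simp add: polys_def)
  then obtain w where "\<forall>i. w i > 0" and w: "strict_mono_on (Poly_Mapping.keys p) (weight_of n w)"
    by (rule weights_refine_lex_order[OF finite_keys])
  obtain G where G: "poly G 0 \<noteq> 0"
    "\<forall>t. poly_eval (monomial_curve n w t) p = t ^ weight_of n w (lowest_monomial p) * poly G t"
    by (rule poly_eval_monomial_curve[OF assms w])
  then have "G \<noteq> 0" by auto
  then obtain d where d: "d > 0" "\<And>t. 0 < t \<Longrightarrow> t < d \<Longrightarrow> poly G t \<noteq> 0"
    by (rule poly_nonzero_near_0) blast
  obtain t where t: "0 < t" "t < d" using dense d(1) by blast
  show ?thesis
    by (rule that[of "monomial_curve n w t"]) (use t d G in \<open>auto simp: affine_space_def\<close>)
qed

section \<open>Local boundedness as an inequality between polynomials\<close>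

definition cube :: "nat \<Rightarrow> (nat \<Rightarrow> 'r::linordered_field) \<Rightarrow> 'r \<Rightarrow> (nat \<Rightarrow> 'r) set" where
  "cube n x e = {y \<in> affine_space n. \<forall>i<n. \<bar>y i - x i\<bar> < e}"

lemma finite_common_lower_bound:
  fixes f :: "nat \<Rightarrow> 'a::linordered_field"
  assumes "\<And>i. i < n \<Longrightarrow> f i > 0"
  obtains e where "e > 0" "\<And>i. i < n \<Longrightarrow> e \<le> f i"
proof (rule that[of "Min (insert 1 (f ` {..<n}))"])
  show "Min (insert 1 (f ` {..<n})) > 0" using assms by (subst Min_gr_iff) auto
qed auto

lemma openin_cube: "openin (euclidean_topology n) (cube n x e)"
proof -
  have eq: "cube n x e = PiE {..<n} (\<lambda>i. {x i - e<..} \<inter> {..<x i + e})"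
    unfolding cube_def affine_space_def
    by (rule Set.set_eqI) (simp only: PiE_iff Int_iff greaterThan_iff lessThan_iff mem_Collect_eq
        abs_diff_less_iff UNIV_I, blast)
  have op: "openin order_topology_of ({x i - e<..} \<inter> {..<x i + e})" for i
    unfolding order_topology_of_def
    by (intro openin_Int topology_generated_by_Basis) auto
  show ?thesis
    unfolding eq euclidean_topology_def openin_PiE[OF finite_lessThan] using op by blast
qed

lemma openin_order_topology_contains_interval:
  fixes a :: "'r::linordered_field"
  assumes "openin order_topology_of U" "a \<in> U"
  shows "\<exists>e>0. \<forall>y. \<bar>y - a\<bar> < e \<longrightarrow> y \<in> U"
proof -
  have "generate_topology_on ({{..<a} | a. True} \<union> {{a<..} | a. True}) U"
    using assms(1) unfolding order_topology_of_def by (rule openin_topology_generated_by)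
  then show ?thesis using assms(2)
  proof induction
    case (Int U V)
    then obtain e e' where "e > 0" "e' > 0" "\<forall>y. \<bar>y - a\<bar> < e \<longrightarrow> y \<in> U" "\<forall>y. \<bar>y - a\<bar> < e' \<longrightarrow> y \<in> V"
      by blast
    then show ?case by (intro exI[of _ "min e e'"]) auto
  next
    case (UN K)
    then show ?case by blast
  next
    case (Basis s)
    then consider b where "s = {..<b}" "a < b" | b where "s = {b<..}" "b < a" by auto
    then show ?case
    proof cases
      case 1
      then show ?thesis by (intro exI[of _ "b - a"]) (auto simp: abs_less_iff)
    next
      case 2
      then show ?thesis by (intro exI[of _ "a - b"]) (auto simp: abs_less_iff)
    qed
  qed auto
qed

lemma openin_contains_cube:
  fixes x :: "nat \<Rightarrow> 'r::linordered_field"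
  assumes "openin (euclidean_topology n) V" "x \<in> V"
  obtains e where "e > 0" "cube n x e \<subseteq> V"
proof -
  obtain U where U: "\<And>i. i < n \<Longrightarrow> openin order_topology_of (U i)" "x \<in> PiE {..<n} U" "PiE {..<n} U \<subseteq> V"
    using assms unfolding euclidean_topology_def openin_product_topology_alt by (metis lessThan_iff)
  have "\<exists>e>0. \<forall>y. \<bar>y - x i\<bar> < e \<longrightarrow> y \<in> U i" if "i < n" for i
    using U that by (intro openin_order_topology_contains_interval) auto
  then obtain f where f: "\<And>i. i < n \<Longrightarrow> f i > 0" "\<And>i y. i < n \<Longrightarrow> \<bar>y - x i\<bar> < f i \<Longrightarrow> y \<in> U i"
    by metis
  obtain e where e: "e > 0" "\<And>i. i < n \<Longrightarrow> e \<le> f i"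
    using finite_common_lower_bound[of n f] f(1) by blast
  have "cube n x e \<subseteq> PiE {..<n} U"
  proof
    fix y
    assume y: "y \<in> cube n x e"
    have "y i \<in> U i" if "i < n" for i
      using y e(2)[OF that] that by (intro f(2)) (auto simp: cube_def)
    with y show "y \<in> PiE {..<n} U" by (auto simp: cube_def affine_space_def)
  qed
  with U(3) e(1) show ?thesis by (intro that) auto
qed

text \<open>The points where \<open>q\<close> does not vanish are dense: the line from \<open>y\<close> to a point
  with \<open>q \<noteq> 0\<close> meets the zeros of \<open>q\<close> finitely often, so the inequality holds
  on that line at all points close to \<open>y\<close> and passes to the limit. This is what makes local
  boundedness independent of the chosen denominator.\<close>

lemma polynomial_bound_extends_from_dense:
  fixes q g h :: "'r::linordered_field mpolynomial"
  assumes q: "q \<in> polys n" "q \<noteq> 0" and gh: "g \<in> polys n" "h \<in> polys n" and "c \<ge> 0"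
    and bound: "\<And>y. y \<in> cube n x e \<Longrightarrow> poly_eval y q \<noteq> 0 \<Longrightarrow>
      \<bar>poly_eval y g\<bar> \<le> c * \<bar>poly_eval y h\<bar>"
    and y: "y \<in> cube n x e"
  shows "\<bar>poly_eval y g\<bar> \<le> c * \<bar>poly_eval y h\<bar>"
proof -
  obtain z where z: "poly_eval z q \<noteq> 0" using poly_nonvanishing_point[OF q] by blast
  \<comment> \<open>The line from \<open>y\<close> (at \<open>t = 0\<close>) to \<open>z\<close> (at \<open>t = 1\<close>), one polynomial per coordinate.\<close>
  define \<gamma> where "\<gamma> i = [:y i, z i - y i:]" for i
  define l where "l t = (\<lambda>i\<in>{..<n}. poly (\<gamma> i) t)" for t
  have ex: "\<exists>G. \<forall>t. poly_eval (l t) p = poly G t" if "p \<in> polys n" for p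
  proof -
    have "poly_eval (l t) p = poly_eval (\<lambda>i. poly (\<gamma> i) t) p" for t
      by (rule poly_eval_cong[OF that]) (simp add: l_def)
    then show ?thesis using poly_eval_along_curve[of \<gamma> p] by simp
  qed
  obtain G H Q where G: "\<And>t. poly_eval (l t) g = poly G t" and H: "\<And>t. poly_eval (l t) h = poly H t"
    and Q: "\<And>t. poly_eval (l t) q = poly Q t"
    using ex[OF gh(1)] ex[OF gh(2)] ex[OF q(1)] by metis
  have l0: "l 0 = y" using y by (auto simp: l_def \<gamma>_def cube_def affine_space_def PiE_def extensional_def)
  have "poly Q 1 = poly_eval z q"
    unfolding Q[symmetric] by (rule poly_eval_cong[OF q(1)]) (simp add: l_def \<gamma>_def)
  with z have "Q \<noteq> 0" by auto
  then obtain d where d: "d > 0" "\<And>t. 0 < t \<Longrightarrow> t < d \<Longrightarrow> poly Q t \<noteq> 0"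
    by (rule poly_nonzero_near_0) blast
  \<comment> \<open>How far along the line coordinate \<open>i\<close> stays within the cube; adding \<open>1\<close> avoids a zero denominator.\<close>
  have pos: "(e - \<bar>y i - x i\<bar>) / (\<bar>z i - y i\<bar> + 1) > 0" if "i < n" for i
    using that y by (intro divide_pos_pos) (auto simp: cube_def)
  obtain d' where d': "d' > 0" "\<And>i. i < n \<Longrightarrow> d' \<le> (e - \<bar>y i - x i\<bar>) / (\<bar>z i - y i\<bar> + 1)"
    using finite_common_lower_bound[of n "\<lambda>i. (e - \<bar>y i - x i\<bar>) / (\<bar>z i - y i\<bar> + 1)", OF pos] by blast
  have lcube: "l t \<in> cube n x e" if t: "0 < t" "t < d'" for t
  proof -
    have "\<bar>l t i - x i\<bar> < e" if "i < n" for i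
    proof -
      have "t < (e - \<bar>y i - x i\<bar>) / (\<bar>z i - y i\<bar> + 1)" using t d'(2)[OF that] by simp
      then have "t * (\<bar>z i - y i\<bar> + 1) < e - \<bar>y i - x i\<bar>"
        by (simp add: pos_less_divide_eq add_nonneg_pos)
      then have "t * \<bar>z i - y i\<bar> < e - \<bar>y i - x i\<bar>" using t(1) by (simp add: algebra_simps)
      moreover have "\<bar>l t i - x i\<bar> \<le> \<bar>y i - x i\<bar> + \<bar>t * (z i - y i)\<bar>"
        using that abs_triangle_ineq[of "y i - x i" "t * (z i - y i)"]
        by (simp add: l_def \<gamma>_def algebra_simps)
      ultimately show ?thesis using t(1) by (simp add: abs_mult)
    qed
    then show ?thesis by (simp add: cube_def affine_space_def l_def)
  qed
  have "\<bar>poly G 0\<bar> \<le> c * \<bar>poly H 0\<bar>"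
  proof (rule poly_bound_at_0)
    show "c \<ge> 0" "min d d' > 0" using \<open>c \<ge> 0\<close> d(1) d'(1) by auto
    fix t
    assume t: "0 < t" "t < min d d'"
    have "\<bar>poly_eval (l t) g\<bar> \<le> c * \<bar>poly_eval (l t) h\<bar>"
      using t d(2)[of t] lcube[of t] Q[of t] by (intro bound) auto
    then show "\<bar>poly G t\<bar> \<le> c * \<bar>poly H t\<bar>" by (simp add: G H)
  qed
  then show ?thesis unfolding G[symmetric] H[symmetric] l0 .
qed

lemma nonvanishing_subset_ratfun_dom:
  fixes p q :: "'r::linordered_field mpolynomial"
  assumes "p \<in> polys n" "q \<in> polys n" "q \<noteq> 0" "x \<in> affine_space n" "poly_eval x q \<noteq> 0"
  shows "x \<in> ratfun_dom n (Fract p q)"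
proof -
  let ?U = "{x \<in> affine_space n. poly_eval x q \<noteq> 0}"
  have "zariski_open n ?U"
    unfolding zariski_open_def using assms(2) by (intro exI[of _ "{q}"]) auto
  moreover have "zariski_dense n ?U"
    unfolding zariski_dense_def
  proof (intro allI impI, elim conjE)
    fix W :: "(nat \<Rightarrow> 'r) set"
    assume "zariski_open n W" "W \<noteq> {}"
    then obtain S y r where S: "S \<subseteq> polys n" "W = {x \<in> affine_space n. \<exists>p \<in> S. poly_eval x p \<noteq> 0}"
      and r: "r \<in> S" "poly_eval y r \<noteq> 0"
      unfolding zariski_open_def by blast
    have "r \<noteq> 0" using r(2) by auto
    then have "q * r \<noteq> 0" using assms(3) by simp
    moreover have "q * r \<in> polys n" using assms(2) S(1) r(1) by (blast intro: polys_mult)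
    ultimately obtain z where "z \<in> affine_space n" "poly_eval z (q * r) \<noteq> 0"
      using poly_nonvanishing_point by blast
    then have "z \<in> ?U \<inter> W" unfolding S(2) using r(1) by (auto simp: poly_eval_mult)
    then show "?U \<inter> W \<noteq> {}" by blast
  qed
  moreover have "regular_on n (Fract p q) ?U"
    unfolding regular_on_def using assms(1-3) by blast
  ultimately show ?thesis unfolding ratfun_dom_def using assms(4,5) by blast
qed

text \<open>The right-hand side mentions neither the domain nor the values of the function. The domain
  of a sum may be larger than the intersection of the domains of the summands, so closure under ring
  operations is awkward with the definition but immediate with this inequality.\<close>

lemma locally_bounded_Fract_iff:
  fixes p q :: "'r::linordered_field mpolynomial"
  assumes pq: "p \<in> polys n" "q \<in> polys n" "q \<noteq> 0"
  shows "locally_bounded n (Fract p q) \<longleftrightarrow>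
    (\<forall>x \<in> affine_space n. \<exists>e>0. \<exists>c\<ge>0. \<forall>y \<in> cube n x e. \<bar>poly_eval y p\<bar> \<le> c * \<bar>poly_eval y q\<bar>)"
    (is "_ \<longleftrightarrow> (\<forall>x \<in> _. ?bounded x)")
proof
  assume lb: "locally_bounded n (Fract p q)"
  show "\<forall>x \<in> affine_space n. ?bounded x"
  proof
    fix x :: "nat \<Rightarrow> 'r"
    assume "x \<in> affine_space n"
    then obtain V where V: "openin (euclidean_topology n) V" "x \<in> V"
      and "bounded_subset (ratfun_value n (Fract p q) ` (V \<inter> ratfun_dom n (Fract p q)))"
      using lb unfolding locally_bounded_def by blast
    then obtain c where "\<forall>v \<in> ratfun_value n (Fract p q) ` (V \<inter> ratfun_dom n (Fract p q)). \<bar>v\<bar> \<le> c"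
      unfolding bounded_subset_def by blast
    then have c: "\<bar>ratfun_value n (Fract p q) y\<bar> \<le> c"
      if "y \<in> V" "y \<in> ratfun_dom n (Fract p q)" for y
      using that by blast
    obtain e where e: "e > 0" "cube n x e \<subseteq> V" using openin_contains_cube[OF V] by blast
    \<comment> \<open>The definition of a bounded set does not fix the sign of its bound.\<close>
    have "\<bar>poly_eval y p\<bar> \<le> max c 0 * \<bar>poly_eval y q\<bar>" if y: "y \<in> cube n x e" for y
    proof (rule polynomial_bound_extends_from_dense[OF pq(2,3,1,2) _ _ y])
      fix y
      assume y: "y \<in> cube n x e" "poly_eval y q \<noteq> 0"
      then have "y \<in> ratfun_dom n (Fract p q)"
        by (intro nonvanishing_subset_ratfun_dom[OF pq]) (auto simp: cube_def)
      then have "\<bar>poly_eval y p / poly_eval y q\<bar> \<le> c"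
        using c[of y] y e(2) ratfun_value_Fract[OF pq(1,2) y(2)] by auto
      then have "\<bar>poly_eval y p\<bar> \<le> c * \<bar>poly_eval y q\<bar>"
        using y(2) by (simp add: abs_divide pos_divide_le_eq)
      also have "\<dots> \<le> max c 0 * \<bar>poly_eval y q\<bar>" by (intro mult_right_mono) auto
      finally show "\<bar>poly_eval y p\<bar> \<le> max c 0 * \<bar>poly_eval y q\<bar>" .
    qed simp
    then show "?bounded x" using e(1) by (meson max.cobounded2)
  qed
next
  assume bd: "\<forall>x \<in> affine_space n. ?bounded x"
  show "locally_bounded n (Fract p q)"
    unfolding locally_bounded_def
  proof
    fix x :: "nat \<Rightarrow> 'r"
    assume x: "x \<in> affine_space n"
    then obtain e c where e: "e > 0" "c \<ge> 0"
      "\<And>y. y \<in> cube n x e \<Longrightarrow> \<bar>poly_eval y p\<bar> \<le> c * \<bar>poly_eval y q\<bar>"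
      using bd by blast
    have "\<bar>ratfun_value n (Fract p q) y\<bar> \<le> c"
      if y: "y \<in> cube n x e" "y \<in> ratfun_dom n (Fract p q)" for y
    proof -
      obtain p' q' where p': "p' \<in> polys n" "q' \<in> polys n" "q' \<noteq> 0" "Fract p q = Fract p' q'"
        "poly_eval y q' \<noteq> 0"
        using y(2) unfolding ratfun_dom_def regular_on_def by blast
      have "p * q' = p' * q" using p' pq(3) by (simp add: eq_fract)
      then have ev: "poly_eval z p * poly_eval z q' = poly_eval z p' * poly_eval z q" for z
        by (metis poly_eval_mult)
      have "\<bar>poly_eval y p'\<bar> \<le> c * \<bar>poly_eval y q'\<bar>"
      proof (rule polynomial_bound_extends_from_dense[OF pq(2,3) p'(1,2) e(2) _ y(1)])
        fix z
        assume z: "z \<in> cube n x e" "poly_eval z q \<noteq> 0"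
        have "\<bar>poly_eval z p'\<bar> * \<bar>poly_eval z q\<bar> = \<bar>poly_eval z p\<bar> * \<bar>poly_eval z q'\<bar>"
          using ev[of z] by (metis abs_mult)
        also have "\<dots> \<le> (c * \<bar>poly_eval z q\<bar>) * \<bar>poly_eval z q'\<bar>"
          by (intro mult_right_mono e(3) z) auto
        finally have "\<bar>poly_eval z q\<bar> * \<bar>poly_eval z p'\<bar> \<le> \<bar>poly_eval z q\<bar> * (c * \<bar>poly_eval z q'\<bar>)"
          by (simp add: mult_ac)
        then show "\<bar>poly_eval z p'\<bar> \<le> c * \<bar>poly_eval z q'\<bar>"
          using z(2) by simp
      qed
      then show ?thesis
        unfolding p'(4) ratfun_value_Fract[OF p'(1,2,5)] using p'(5)
        by (simp add: abs_divide pos_divide_le_eq)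
    qed
    then have "bounded_subset (ratfun_value n (Fract p q) ` (cube n x e \<inter> ratfun_dom n (Fract p q)))"
      unfolding bounded_subset_def by blast
    moreover have "x \<in> cube n x e" using x e(1) by (simp add: cube_def)
    ultimately show "\<exists>V. openin (euclidean_topology n) V \<and> x \<in> V \<and>
        bounded_subset (ratfun_value n (Fract p q) ` (V \<inter> ratfun_dom n (Fract p q)))"
      using openin_cube by blast
  qed
qed

section \<open>Prime ideals of a subring of a field\<close>

abbreviation subring_structure :: "'k::field set \<Rightarrow> 'k ring" where
  "subring_structure A \<equiv> ring_of_type_algebra\<lparr>carrier := A\<rparr>"

lemma ring_of_type_algebra_simps:
  "x \<otimes>\<^bsub>ring_of_type_algebra\<^esub> y = x * y" "x \<oplus>\<^bsub>ring_of_type_algebra\<^esub> y = x + y"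
  "\<one>\<^bsub>ring_of_type_algebra\<^esub> = 1" "\<zero>\<^bsub>ring_of_type_algebra\<^esub> = 0"
  by (simp_all add: ring_of_type_algebra_def)

definition closed_subring :: "'k::field set \<Rightarrow> bool" where
  "closed_subring A \<longleftrightarrow> 0 \<in> A \<and> 1 \<in> A \<and> (\<forall>x\<in>A. - x \<in> A) \<and>
     (\<forall>x\<in>A. \<forall>y\<in>A. x + y \<in> A) \<and> (\<forall>x\<in>A. \<forall>y\<in>A. x * y \<in> A)"

text \<open>Restates the primality of the record-based ideals in terms of the field operations, so that
  the arguments below take place inside one field.\<close>

definition prime_ideal_of :: "'k::field set \<Rightarrow> 'k set \<Rightarrow> bool" where
  "prime_ideal_of A P \<longleftrightarrow> P \<subseteq> A \<and> 0 \<in> P \<and> 1 \<notin> P \<and> (\<forall>x\<in>P. \<forall>y\<in>P. x + y \<in> P) \<and>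
     (\<forall>x\<in>P. \<forall>r\<in>A. r * x \<in> P) \<and> (\<forall>x\<in>A. \<forall>y\<in>A. x * y \<in> P \<longrightarrow> x \<in> P \<or> y \<in> P)"

lemma cring_subring_structure:
  assumes "closed_subring A"
  shows "cring (subring_structure A)"
proof (rule cringI)
  have "\<exists>y\<in>A. y + x = 0" if "x \<in> A" for x
    using assms that by (intro bexI[of _ "- x"]) (auto simp: closed_subring_def)
  then show "abelian_group (subring_structure A)"
    using assms by (intro abelian_groupI) (auto simp: ring_of_type_algebra_simps closed_subring_def)
  show "comm_monoid (subring_structure A)"
    using assms by (intro comm_monoidI) (auto simp: ring_of_type_algebra_simps closed_subring_def)
qed (auto simp: ring_of_type_algebra_simps distrib_right)

lemma primeideal_subring_structure_iff:
  assumes A: "closed_subring A"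
  shows "primeideal P (subring_structure A) \<longleftrightarrow> prime_ideal_of A P"
proof
  assume "primeideal P (subring_structure A)"
  then interpret primeideal P "subring_structure A" .
  have "P \<subseteq> A" using a_subset by (simp add: ring_of_type_algebra_simps)
  moreover have "0 \<in> P"
    using additive_subgroup.zero_closed[OF additive_subgroup_axioms]
    by (simp add: ring_of_type_algebra_simps)
  moreover have "x + y \<in> P" if "x \<in> P" "y \<in> P" for x y
    using additive_subgroup.a_closed[OF additive_subgroup_axioms that] by (simp add: ring_of_type_algebra_simps)
  moreover have mult: "r * x \<in> P" if "x \<in> P" "r \<in> A" for x r
    using I_l_closed[of x r] that by (simp add: ring_of_type_algebra_simps)
  moreover have "x \<in> P \<or> y \<in> P" if "x \<in> A" "y \<in> A" "x * y \<in> P" for x y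
    using I_prime[of x y] that by (simp add: ring_of_type_algebra_simps)
  moreover have "1 \<notin> P"
  proof
    assume "1 \<in> P"
    then have "A \<subseteq> P" using mult[of 1] by auto
    then show False using I_notcarr \<open>P \<subseteq> A\<close> by (simp add: ring_of_type_algebra_simps)
  qed
  ultimately show "prime_ideal_of A P" unfolding prime_ideal_of_def by simp
next
  assume P: "prime_ideal_of A P"
  interpret R: cring "subring_structure A" by (rule cring_subring_structure[OF A])
  have uminus: "- x \<in> P" if "x \<in> P" for x
  proof -
    have "(- 1) * x \<in> P" using that P A unfolding prime_ideal_of_def closed_subring_def by blast
    then show ?thesis by simp
  qed
  have a_inv: "\<ominus>\<^bsub>subring_structure A\<^esub> x = - x" if "x \<in> A" for x
    by (rule R.minus_equality)
      (use that A in \<open>auto simp: ring_of_type_algebra_simps closed_subring_def\<close>)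
  show "primeideal P (subring_structure A)"
  proof (rule primeidealI)
    show "ideal P (subring_structure A)"
    proof (rule idealI)
      show "ring (subring_structure A)" by (rule R.ring_axioms)
      show "subgroup P (add_monoid (subring_structure A))"
      proof (rule subgroup.intro)
        fix x
        assume "x \<in> P"
        moreover from this have "x \<in> A" using P by (auto simp: prime_ideal_of_def)
        ultimately show "inv\<^bsub>add_monoid (subring_structure A)\<^esub> x \<in> P"
          using uminus a_inv[of x] by (simp add: a_inv_def)
      qed (use P in \<open>auto simp: ring_of_type_algebra_simps prime_ideal_of_def\<close>)
    qed (use P in \<open>auto simp: ring_of_type_algebra_simps prime_ideal_of_def mult.commute\<close>)
    show "cring (subring_structure A)" by (rule R.is_cring)
  qed (use P A in \<open>auto simp: ring_of_type_algebra_simps prime_ideal_of_def closed_subring_def\<close>)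
qed

section \<open>The ring of locally bounded rational functions\<close>

definition lb_ratfuns :: "nat \<Rightarrow> 'r::linordered_field ratfun set" where
  "lb_ratfuns n = {f \<in> ratfuns n. locally_bounded n f}"

lemma lb_ratfuns_subset: "lb_ratfuns n \<subseteq> ratfuns n"
  by (auto simp: lb_ratfuns_def)

definition const_ratfun :: "'r::linordered_field \<Rightarrow> 'r ratfun" where
  "const_ratfun c = Fract (Poly_Mapping.single 0 c) 1"

lemma const_ratfun_simps:
  "const_ratfun 0 = 0" "const_ratfun 1 = 1"
  "const_ratfun (a + b) = const_ratfun a + const_ratfun b"
  "const_ratfun (a * b) = const_ratfun a * const_ratfun b"
  "const_ratfun (- a) = - const_ratfun a"
  by (simp_all add: const_ratfun_def fract_collapse single_add mult_single single_uminus)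

lemma const_ratfun_eq_0_iff: "const_ratfun c = 0 \<longleftrightarrow> c = 0"
proof -
  have "Poly_Mapping.single 0 c = (0 :: 'a mpolynomial) \<longleftrightarrow> c = 0"
    by (metis lookup_single_eq lookup_zero single_zero)
  then show ?thesis by (simp add: const_ratfun_def Zero_fract_def eq_fract)
qed

lemma inverse_const_ratfun: "c \<noteq> 0 \<Longrightarrow> inverse (const_ratfun c) = const_ratfun (inverse c)"
  by (rule inverse_unique) (simp add: const_ratfun_simps(2,4)[symmetric] flip: const_ratfun_simps)

lemma lb_ratfuns_cases:
  assumes "f \<in> lb_ratfuns n"
  obtains p q where "p \<in> polys n" "q \<in> polys n" "q \<noteq> 0" "f = Fract p q"
    "\<forall>x \<in> affine_space n. \<exists>e>0. \<exists>c\<ge>0. \<forall>y \<in> cube n x e. \<bar>poly_eval y p\<bar> \<le> c * \<bar>poly_eval y q\<bar>"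
proof -
  obtain p q where pq: "p \<in> polys n" "q \<in> polys n" "q \<noteq> 0" "f = Fract p q"
    using assms unfolding lb_ratfuns_def ratfuns_def by blast
  moreover have "locally_bounded n (Fract p q)" using assms pq(4) by (simp add: lb_ratfuns_def)
  ultimately show ?thesis using locally_bounded_Fract_iff[OF pq(1-3)] that by blast
qed

lemma lb_ratfunsI:
  assumes "p \<in> polys n" "q \<in> polys n" "q \<noteq> 0"
    and "\<And>x. x \<in> affine_space n \<Longrightarrow>
      \<exists>e>0. \<exists>c\<ge>0. \<forall>y \<in> cube n x e. \<bar>poly_eval y p\<bar> \<le> c * \<bar>poly_eval y q\<bar>"
  shows "Fract p q \<in> lb_ratfuns n"
  unfolding lb_ratfuns_def ratfuns_def using locally_bounded_Fract_iff[OF assms(1-3)] assms by blast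

lemma polynomial_in_lb_ratfuns:
  fixes p :: "'r::linordered_field mpolynomial"
  assumes p: "p \<in> polys n"
  shows "Fract p 1 \<in> lb_ratfuns n"
proof (rule lb_ratfunsI[OF p polys_one])
  fix x :: "nat \<Rightarrow> 'r"
  define c where "c = (\<Sum>m \<in> Poly_Mapping.keys p. \<bar>Poly_Mapping.lookup p m\<bar> *
    (\<Prod>i \<in> Poly_Mapping.keys m. (\<bar>x i\<bar> + 1) ^ Poly_Mapping.lookup m i))"
  have "\<bar>poly_eval y p\<bar> \<le> c" if y: "y \<in> cube n x 1" for y
  proof -
    have "\<bar>poly_eval y p\<bar> \<le> (\<Sum>m \<in> Poly_Mapping.keys p. \<bar>Poly_Mapping.lookup p m * monom_eval y m\<bar>)"
      unfolding poly_eval_def by (rule sum_abs)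
    also have "\<dots> \<le> c"
      unfolding c_def
    proof (rule sum_mono)
      fix m
      assume "m \<in> Poly_Mapping.keys p"
      then have m: "Poly_Mapping.keys m \<subseteq> {..<n}" using p by (auto simp: polys_def)
      have "\<bar>monom_eval y m\<bar> \<le> (\<Prod>i \<in> Poly_Mapping.keys m. (\<bar>x i\<bar> + 1) ^ Poly_Mapping.lookup m i)"
        unfolding abs_prod
      proof (rule prod_mono)
        fix i
        assume "i \<in> Poly_Mapping.keys m"
        then have "\<bar>y i - x i\<bar> < 1" using y m by (auto simp: cube_def)
        then have "\<bar>y i\<bar> \<le> \<bar>x i\<bar> + 1" using abs_triangle_ineq2[of "y i" "x i"] by linarith
        then show "0 \<le> \<bar>y i ^ Poly_Mapping.lookup m i\<bar> \<and>
            \<bar>y i ^ Poly_Mapping.lookup m i\<bar> \<le> (\<bar>x i\<bar> + 1) ^ Poly_Mapping.lookup m i"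
          by (simp add: power_abs power_mono)
      qed
      then show "\<bar>Poly_Mapping.lookup p m * monom_eval y m\<bar> \<le> \<bar>Poly_Mapping.lookup p m\<bar> *
          (\<Prod>i \<in> Poly_Mapping.keys m. (\<bar>x i\<bar> + 1) ^ Poly_Mapping.lookup m i)"
        by (simp only: abs_mult) (intro mult_left_mono, auto)
    qed
    finally show ?thesis .
  qed
  moreover have "c \<ge> 0"
    unfolding c_def by (intro sum_nonneg mult_nonneg_nonneg prod_nonneg) auto
  ultimately show "\<exists>e>0. \<exists>c\<ge>0. \<forall>y \<in> cube n x e. \<bar>poly_eval y p\<bar> \<le> c * \<bar>poly_eval y 1\<bar>"
    by (intro exI[of _ 1] exI[of _ c] conjI) auto
qed simp

lemma const_in_lb_ratfuns: "const_ratfun c \<in> lb_ratfuns n"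
  unfolding const_ratfun_def by (intro polynomial_in_lb_ratfuns polys_single) simp

lemma cube_mono: "d \<le> e \<Longrightarrow> cube n x d \<subseteq> cube n x e"
  unfolding cube_def by fastforce

lemma lb_ratfuns_add:
  assumes f: "f \<in> lb_ratfuns n" and g: "g \<in> lb_ratfuns n"
  shows "f + g \<in> lb_ratfuns n"
proof -
  obtain p q where pq: "p \<in> polys n" "q \<in> polys n" "q \<noteq> 0" "f = Fract p q"
    "\<forall>x \<in> affine_space n. \<exists>e>0. \<exists>c\<ge>0. \<forall>y \<in> cube n x e. \<bar>poly_eval y p\<bar> \<le> c * \<bar>poly_eval y q\<bar>"
    using f by (rule lb_ratfuns_cases)
  obtain r s where rs: "r \<in> polys n" "s \<in> polys n" "s \<noteq> 0" "g = Fract r s"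
    "\<forall>x \<in> affine_space n. \<exists>e>0. \<exists>c\<ge>0. \<forall>y \<in> cube n x e. \<bar>poly_eval y r\<bar> \<le> c * \<bar>poly_eval y s\<bar>"
    using g by (rule lb_ratfuns_cases)
  have "Fract (p * s + r * q) (q * s) \<in> lb_ratfuns n"
  proof (rule lb_ratfunsI)
    fix x :: "nat \<Rightarrow> 'a"
    assume x: "x \<in> affine_space n"
    obtain e c where e: "e > 0" "c \<ge> 0" "\<forall>y \<in> cube n x e. \<bar>poly_eval y p\<bar> \<le> c * \<bar>poly_eval y q\<bar>"
      using pq(5) x by blast
    obtain e' c' where e': "e' > 0" "c' \<ge> 0"
      "\<forall>y \<in> cube n x e'. \<bar>poly_eval y r\<bar> \<le> c' * \<bar>poly_eval y s\<bar>"
      using rs(5) x by blast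
    have "\<bar>poly_eval y (p * s + r * q)\<bar> \<le> (c + c') * \<bar>poly_eval y (q * s)\<bar>"
      if y: "y \<in> cube n x (min e e')" for y
    proof -
      have y': "y \<in> cube n x e" "y \<in> cube n x e'" using y cube_mono[of "min e e'" e n x] cube_mono[of "min e e'" e' n x] by auto
      have "\<bar>poly_eval y (p * s + r * q)\<bar>
          \<le> \<bar>poly_eval y p\<bar> * \<bar>poly_eval y s\<bar> + \<bar>poly_eval y r\<bar> * \<bar>poly_eval y q\<bar>"
        unfolding poly_eval_add poly_eval_mult abs_mult[symmetric] by (rule abs_triangle_ineq)
      also have "\<dots> \<le> (c * \<bar>poly_eval y q\<bar>) * \<bar>poly_eval y s\<bar> + (c' * \<bar>poly_eval y s\<bar>) * \<bar>poly_eval y q\<bar>"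
        using e(3) e'(3) y' by (intro add_mono mult_right_mono) auto
      also have "\<dots> = (c + c') * \<bar>poly_eval y (q * s)\<bar>"
        unfolding poly_eval_mult abs_mult by (simp add: algebra_simps)
      finally show ?thesis .
    qed
    then show "\<exists>e>0. \<exists>c\<ge>0. \<forall>y \<in> cube n x e. \<bar>poly_eval y (p * s + r * q)\<bar> \<le> c * \<bar>poly_eval y (q * s)\<bar>"
      using e(1,2) e'(1,2) by (intro exI[of _ "min e e'"] exI[of _ "c + c'"] conjI) auto
  qed (use pq rs in \<open>auto intro: polys_add polys_mult\<close>)
  then show ?thesis using pq(3,4) rs(3,4) by simp
qed

lemma lb_ratfuns_mult:
  assumes f: "f \<in> lb_ratfuns n" and g: "g \<in> lb_ratfuns n"
  shows "f * g \<in> lb_ratfuns n"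
proof -
  obtain p q where pq: "p \<in> polys n" "q \<in> polys n" "q \<noteq> 0" "f = Fract p q"
    "\<forall>x \<in> affine_space n. \<exists>e>0. \<exists>c\<ge>0. \<forall>y \<in> cube n x e. \<bar>poly_eval y p\<bar> \<le> c * \<bar>poly_eval y q\<bar>"
    using f by (rule lb_ratfuns_cases)
  obtain r s where rs: "r \<in> polys n" "s \<in> polys n" "s \<noteq> 0" "g = Fract r s"
    "\<forall>x \<in> affine_space n. \<exists>e>0. \<exists>c\<ge>0. \<forall>y \<in> cube n x e. \<bar>poly_eval y r\<bar> \<le> c * \<bar>poly_eval y s\<bar>"
    using g by (rule lb_ratfuns_cases)
  have "Fract (p * r) (q * s) \<in> lb_ratfuns n"
  proof (rule lb_ratfunsI)
    fix x :: "nat \<Rightarrow> 'a"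
    assume x: "x \<in> affine_space n"
    obtain e c where e: "e > 0" "c \<ge> 0" "\<forall>y \<in> cube n x e. \<bar>poly_eval y p\<bar> \<le> c * \<bar>poly_eval y q\<bar>"
      using pq(5) x by blast
    obtain e' c' where e': "e' > 0" "c' \<ge> 0"
      "\<forall>y \<in> cube n x e'. \<bar>poly_eval y r\<bar> \<le> c' * \<bar>poly_eval y s\<bar>"
      using rs(5) x by blast
    have "\<bar>poly_eval y (p * r)\<bar> \<le> (c * c') * \<bar>poly_eval y (q * s)\<bar>"
      if y: "y \<in> cube n x (min e e')" for y
    proof -
      have y': "y \<in> cube n x e" "y \<in> cube n x e'" using y cube_mono[of "min e e'" e n x] cube_mono[of "min e e'" e' n x] by auto
      have "\<bar>poly_eval y (p * r)\<bar> \<le> (c * \<bar>poly_eval y q\<bar>) * (c' * \<bar>poly_eval y s\<bar>)"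
        unfolding poly_eval_mult abs_mult using e(2,3) e'(3) y' by (intro mult_mono) auto
      also have "\<dots> = (c * c') * \<bar>poly_eval y (q * s)\<bar>"
        unfolding poly_eval_mult abs_mult by (simp add: mult_ac)
      finally show ?thesis .
    qed
    then show "\<exists>e>0. \<exists>c\<ge>0. \<forall>y \<in> cube n x e. \<bar>poly_eval y (p * r)\<bar> \<le> c * \<bar>poly_eval y (q * s)\<bar>"
      using e(1,2) e'(1,2) by (intro exI[of _ "min e e'"] exI[of _ "c * c'"] conjI) auto
  qed (use pq rs in \<open>auto intro: polys_mult\<close>)
  then show ?thesis using pq(4) rs(4) by simp
qed

lemma closed_subring_lb_ratfuns: "closed_subring (lb_ratfuns n :: 'r::linordered_field ratfun set)"
proof -
  have "- f \<in> lb_ratfuns n" if "f \<in> lb_ratfuns n" for f :: "'r ratfun"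
    using lb_ratfuns_mult[OF const_in_lb_ratfuns[of "- 1"] that] by (simp add: const_ratfun_simps)
  moreover have "(0 :: 'r ratfun) \<in> lb_ratfuns n" "(1 :: 'r ratfun) \<in> lb_ratfuns n"
    using const_in_lb_ratfuns[of "0 :: 'r" n] const_in_lb_ratfuns[of "1 :: 'r" n]
    by (simp_all add: const_ratfun_simps)
  ultimately show ?thesis
    unfolding closed_subring_def using lb_ratfuns_add lb_ratfuns_mult by blast
qed

section \<open>The lexicographic valuation and its chain of primes\<close>

text \<open>Additivity, which makes
  \<open>p / q \<mapsto> lowest_monomial p - lowest_monomial q\<close> a valuation: in the product,
  the sum of the two lowest monomials arises from one pair only, so its coefficient cannot
  cancel.\<close>

lemma lowest_monomial_mult:
  fixes p q :: "'r::linordered_field mpolynomial"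
  assumes "p \<noteq> 0" "q \<noteq> 0"
  shows "lowest_monomial (p * q) = lowest_monomial p + lowest_monomial q"
proof (rule Min_eqI)
  define a b where "a = lowest_monomial p" and "b = lowest_monomial q"
  have ab: "a \<in> Poly_Mapping.keys p" "b \<in> Poly_Mapping.keys q"
    unfolding a_def b_def using assms by (auto intro: lowest_monomial_in_keys)
  have ge: "a \<le> m" "b \<le> l" if "m \<in> Poly_Mapping.keys p" "l \<in> Poly_Mapping.keys q" for m l
    using that by (auto simp: a_def b_def)
  have eq: "m + l = a + b \<longleftrightarrow> m = a \<and> l = b"
    if "m \<in> Poly_Mapping.keys p" "l \<in> Poly_Mapping.keys q" for m l
    using ge[OF that] add_less_le_mono[of a m b l] add_le_less_mono[of a m b l]
    by (metis order_less_le order_less_irrefl)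
  have "p * q = (\<Sum>m \<in> Poly_Mapping.keys p. \<Sum>l \<in> Poly_Mapping.keys q.
      Poly_Mapping.single (m + l) (Poly_Mapping.lookup p m * Poly_Mapping.lookup q l))"
    by (subst (1) poly_mapping_sum_single[of p], subst (1) poly_mapping_sum_single[of q])
       (simp only: sum_product mult_single)
  then have "Poly_Mapping.lookup (p * q) (a + b) =
      (\<Sum>m \<in> Poly_Mapping.keys p. \<Sum>l \<in> Poly_Mapping.keys q.
        (if m + l = a + b then Poly_Mapping.lookup p m * Poly_Mapping.lookup q l else 0))"
    by (simp add: lookup_sum lookup_single when_def)
  also have "\<dots> = (\<Sum>m \<in> Poly_Mapping.keys p. \<Sum>l \<in> Poly_Mapping.keys q.
        (if m = a then if l = b then Poly_Mapping.lookup p m * Poly_Mapping.lookup q l else 0 else 0))"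
    by (intro sum.cong refl) (simp add: eq)
  also have "\<dots> = (\<Sum>m \<in> Poly_Mapping.keys p. if m = a then
        (\<Sum>l \<in> Poly_Mapping.keys q. if l = b then Poly_Mapping.lookup p m * Poly_Mapping.lookup q l else 0) else 0)"
    by (intro sum.cong refl) simp
  also have "\<dots> = Poly_Mapping.lookup p a * Poly_Mapping.lookup q b"
    using ab by (simp add: sum.delta)
  finally have "Poly_Mapping.lookup (p * q) (a + b) \<noteq> 0" using ab by (simp add: in_keys_iff)
  then show "lowest_monomial p + lowest_monomial q \<in> Poly_Mapping.keys (p * q)"
    by (simp add: in_keys_iff a_def b_def)
  fix m
  assume "m \<in> Poly_Mapping.keys (p * q)"
  then obtain k l where "m = k + l" "k \<in> Poly_Mapping.keys p" "l \<in> Poly_Mapping.keys q"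
    by (rule keys_mult_imp)
  then show "lowest_monomial p + lowest_monomial q \<le> m"
    using ge by (auto simp: a_def b_def intro: add_mono)
qed simp

lemma lowest_monomial_add:
  assumes "p + q \<noteq> 0"
  shows "lowest_monomial (p + q) \<in> Poly_Mapping.keys p \<union> Poly_Mapping.keys q"
  using lowest_monomial_in_keys[OF assms] Poly_Mapping.keys_add[of p q] by blast

lemma lowest_monomial_single: "c \<noteq> 0 \<Longrightarrow> lowest_monomial (Poly_Mapping.single m c) = m"
  by simp

text \<open>Truncation to the first \<open>k\<close> exponents is additive and monotone for the lexicographic
  order, so composing the lexicographic valuation with it gives a coarser valuation.\<close>

definition initial_part :: "nat \<Rightarrow> (nat \<Rightarrow>\<^sub>0 nat) \<Rightarrow> (nat \<Rightarrow>\<^sub>0 nat)" where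
  "initial_part k m = Abs_poly_mapping (\<lambda>i. Poly_Mapping.lookup m i when i < k)"

lemma lookup_initial_part:
  "Poly_Mapping.lookup (initial_part k m) i = (if i < k then Poly_Mapping.lookup m i else 0)"
  unfolding initial_part_def by (subst lookup_Abs_poly_mapping) (auto simp: when_def)

lemma initial_part_add: "initial_part k (a + b) = initial_part k a + initial_part k b"
  by (rule poly_mapping_eqI) (simp add: lookup_initial_part lookup_add)

lemma initial_part_mono:
  assumes "a \<le> b"
  shows "initial_part k a \<le> initial_part k b"
proof (cases "a = b")
  case False
  with assms have "a < b" by simp
  then obtain j where j: "Poly_Mapping.lookup a j < Poly_Mapping.lookup b j"
    "\<forall>i<j. Poly_Mapping.lookup a i = Poly_Mapping.lookup b i"
    by (auto simp: less_poly_mapping.rep_eq less_fun_def)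
  show ?thesis
  proof (cases "j < k")
    case True
    then have "initial_part k a < initial_part k b"
      using j by (auto simp: less_poly_mapping.rep_eq less_fun_def lookup_initial_part intro!: exI[of _ j])
    then show ?thesis by simp
  next
    case False
    then have "initial_part k a = initial_part k b"
      using j(2) by (intro poly_mapping_eqI) (auto simp: lookup_initial_part)
    then show ?thesis by simp
  qed
qed simp

lemma initial_part_initial_part: "j \<le> k \<Longrightarrow> initial_part j (initial_part k m) = initial_part j m"
  by (rule poly_mapping_eqI) (simp add: lookup_initial_part)

text \<open>The locally bounded functions lie in the valuation ring of the lexicographic valuation. If
  the numerator had the lower monomial, then along a monomial curve into the origin the numerator
  would vanish to smaller order than the denominator, and the quotient would be unbounded.\<close>

lemma locally_bounded_imp_lowest_monomial_le:
  fixes p q :: "'r::linordered_field mpolynomial"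
  assumes pq: "p \<in> polys n" "q \<in> polys n" "p \<noteq> 0" "q \<noteq> 0" and lb: "Fract p q \<in> lb_ratfuns n"
  shows "lowest_monomial q \<le> lowest_monomial p"
proof (rule ccontr)
  assume "\<not> lowest_monomial q \<le> lowest_monomial p"
  then have less: "lowest_monomial p < lowest_monomial q" by simp
  let ?K = "Poly_Mapping.keys p \<union> Poly_Mapping.keys q"
  have "\<forall>m \<in> ?K. Poly_Mapping.keys m \<subseteq> {..<n}"
    using pq(1,2) by (auto simp: polys_def)
  moreover have "finite ?K" by simp
  ultimately obtain w where wpos: "\<forall>i. w i > 0" and w: "strict_mono_on ?K (weight_of n w)"
    using weights_refine_lex_order by metis
  have wp: "strict_mono_on (Poly_Mapping.keys p) (weight_of n w)"
    and wq: "strict_mono_on (Poly_Mapping.keys q) (weight_of n w)"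
    using w by (auto intro: monotone_on_subset)
  obtain G where G: "poly G 0 \<noteq> 0"
    "\<forall>t. poly_eval (monomial_curve n w t) p = t ^ weight_of n w (lowest_monomial p) * poly G t"
    by (rule poly_eval_monomial_curve[OF pq(1,3) wp])
  obtain H where H: "poly H 0 \<noteq> 0"
    "\<forall>t. poly_eval (monomial_curve n w t) q = t ^ weight_of n w (lowest_monomial q) * poly H t"
    by (rule poly_eval_monomial_curve[OF pq(2,4) wq])
  define k where "k = weight_of n w (lowest_monomial q) - weight_of n w (lowest_monomial p)"
  have "weight_of n w (lowest_monomial p) < weight_of n w (lowest_monomial q)"
    using less lowest_monomial_in_keys pq(3,4) by (intro strict_mono_onD[OF w]) auto
  then have k: "k > 0" "weight_of n w (lowest_monomial q) = weight_of n w (lowest_monomial p) + k"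
    unfolding k_def by auto
  define z where "z = (\<lambda>i\<in>{..<n}. 0 :: 'r)"
  have "z \<in> affine_space n" by (simp add: z_def affine_space_def)
  moreover have "locally_bounded n (Fract p q)" using lb by (simp add: lb_ratfuns_def)
  ultimately obtain e c where e: "e > 0" "c \<ge> 0"
    "\<forall>y \<in> cube n z e. \<bar>poly_eval y p\<bar> \<le> c * \<bar>poly_eval y q\<bar>"
    using locally_bounded_Fract_iff[OF pq(1,2,4)] by blast
  \<comment> \<open>Cancelling the common power of \<open>t\<close> leaves a factor \<open>t\<^sup>k\<close> on the right, which vanishes in the limit.\<close>
  have "\<bar>poly G 0\<bar> \<le> c * \<bar>poly (Polynomial.monom 1 k * H) 0\<bar>"
  proof (rule poly_bound_at_0)
    show "c \<ge> 0" by fact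
    show "min 1 e > 0" using e(1) by simp
    fix t :: 'r
    assume t: "0 < t" "t < min 1 e"
    have "t ^ w i \<le> t" for i
      using power_decreasing[of 1 "w i" t] wpos t by (simp add: Suc_leI)
    then have "\<bar>t ^ w i\<bar> < e" for i
      using t by (metis abs_of_pos le_less_trans min_less_iff_conj zero_less_power)
    then have "monomial_curve n w t \<in> cube n z e"
      by (simp add: cube_def affine_space_def z_def)
    then have "\<bar>t ^ weight_of n w (lowest_monomial p) * poly G t\<bar>
        \<le> c * \<bar>t ^ weight_of n w (lowest_monomial q) * poly H t\<bar>"
      using e(3) G(2) H(2) by metis
    then have "t ^ weight_of n w (lowest_monomial p) * \<bar>poly G t\<bar>
        \<le> t ^ weight_of n w (lowest_monomial p) * (c * \<bar>t ^ k * poly H t\<bar>)"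
      using t by (simp add: k(2) power_add abs_mult mult_ac)
    then show "\<bar>poly G t\<bar> \<le> c * \<bar>poly (Polynomial.monom 1 k * H) t\<bar>"
      using t by (simp add: poly_monom)
  qed
  then show False using G(1) by (simp add: poly_monom zero_power[OF k(1)])
qed

text \<open>The intersection of the ring with the maximal ideal of the valuation coarsened to the first
  \<open>k\<close> exponents: the first \<open>k\<close> entries of the value are lexicographically positive. The
  case \<open>p = 0\<close> is separate because the lowest monomial of the zero polynomial is
  unspecified.\<close>

definition lex_prime :: "nat \<Rightarrow> nat \<Rightarrow> 'r::linordered_field ratfun set" where
  "lex_prime n k = {f \<in> lb_ratfuns n. \<exists>p \<in> polys n. \<exists>q \<in> polys n. q \<noteq> 0 \<and> f = Fract p q \<and>
     (p = 0 \<or> initial_part k (lowest_monomial q) < initial_part k (lowest_monomial p))}"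

text \<open>If \<open>p / q = r / s\<close>, then \<open>p * s = r * q\<close>, and by additivity of
  lowest monomials both fractions have the same value, so the condition can be tested on any
  fraction.\<close>

lemma Fract_in_lex_prime_iff:
  fixes p q :: "'r::linordered_field mpolynomial"
  assumes pq: "p \<in> polys n" "q \<in> polys n" "p \<noteq> 0" "q \<noteq> 0" and lb: "Fract p q \<in> lb_ratfuns n"
  shows "Fract p q \<in> lex_prime n k \<longleftrightarrow>
    initial_part k (lowest_monomial q) < initial_part k (lowest_monomial p)"
proof
  assume "Fract p q \<in> lex_prime n k"
  then obtain r s where rs: "r \<in> polys n" "s \<in> polys n" "s \<noteq> 0" "Fract p q = Fract r s"
    "r = 0 \<or> initial_part k (lowest_monomial s) < initial_part k (lowest_monomial r)"
    unfolding lex_prime_def by blast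
  have eq: "p * s = r * q" using rs pq by (simp add: eq_fract)
  then have "r \<noteq> 0" using pq(3) rs(3) by auto
  then have less: "initial_part k (lowest_monomial s) < initial_part k (lowest_monomial r)"
    using rs(5) by blast
  have "lowest_monomial p + lowest_monomial s = lowest_monomial r + lowest_monomial q"
    using eq pq rs(3) \<open>r \<noteq> 0\<close> by (metis lowest_monomial_mult)
  then have "initial_part k (lowest_monomial p) + initial_part k (lowest_monomial s)
      = initial_part k (lowest_monomial r) + initial_part k (lowest_monomial q)"
    by (metis initial_part_add)
  moreover have "initial_part k (lowest_monomial s) + initial_part k (lowest_monomial q)
      < initial_part k (lowest_monomial r) + initial_part k (lowest_monomial q)"
    using less by (rule add_strict_right_mono)
  ultimately show "initial_part k (lowest_monomial q) < initial_part k (lowest_monomial p)"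
    by (metis add.commute add_less_cancel_left)
qed (use assms in \<open>auto simp: lex_prime_def\<close>)

lemma nonzero_lb_ratfun_cases:
  assumes "f \<in> lb_ratfuns n" "f \<noteq> 0"
  obtains p q where "p \<in> polys n" "q \<in> polys n" "p \<noteq> 0" "q \<noteq> 0" "f = Fract p q"
    "lowest_monomial q \<le> lowest_monomial p"
    "\<forall>k. f \<in> lex_prime n k \<longleftrightarrow> initial_part k (lowest_monomial q) < initial_part k (lowest_monomial p)"
proof -
  obtain p q where pq: "p \<in> polys n" "q \<in> polys n" "q \<noteq> 0" "f = Fract p q"
    using assms(1) by (rule lb_ratfuns_cases)
  have p: "p \<noteq> 0" using assms(2) pq(4) by (auto simp: fract_collapse)
  have lb: "Fract p q \<in> lb_ratfuns n" using assms(1) pq(4) by simp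
  show ?thesis
    using pq p locally_bounded_imp_lowest_monomial_le[OF pq(1,2) p pq(3) lb]
      Fract_in_lex_prime_iff[OF pq(1,2) p pq(3) lb] by (intro that[of p q]) auto
qed

lemma zero_in_lex_prime: "(0 :: 'r::linordered_field ratfun) \<in> lex_prime n k"
  unfolding lex_prime_def
proof (intro CollectI conjI bexI)
  show "(0 :: 'r ratfun) \<in> lb_ratfuns n"
    using closed_subring_lb_ratfuns[of n, where 'r='r] by (simp add: closed_subring_def)
  show "(0 :: 'r ratfun) = Fract 0 1" by (rule Zero_fract_def)
qed (auto intro: polys_zero polys_one)

text \<open>Additivity of the value gives primality, and the value of a sum is at least one of the two
  values. Absorption is where the valuation ring matters: multiplying by \<open>g\<close> keeps the value
  positive because the value of \<open>g\<close> is not negative.\<close>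

lemma prime_ideal_lex_prime: "prime_ideal_of (lb_ratfuns n) (lex_prime n k :: 'r::linordered_field ratfun set)"
proof -
  have sub: "lex_prime n k \<subseteq> (lb_ratfuns n :: 'r ratfun set)" unfolding lex_prime_def by blast
  have one: "(1 :: 'r ratfun) \<notin> lex_prime n k"
  proof -
    have "(1 :: 'r ratfun) \<in> lb_ratfuns n"
      using closed_subring_lb_ratfuns[of n, where 'r='r] by (simp add: closed_subring_def)
    then show ?thesis
      using Fract_in_lex_prime_iff[OF polys_one polys_one, of n k, where 'r='r]
      by (simp add: One_fract_def)
  qed
  have add: "f + g \<in> lex_prime n k" if "f \<in> lex_prime n k" "g \<in> lex_prime n k" for f g :: "'r ratfun"
  proof -
    have lb: "f \<in> lb_ratfuns n" "g \<in> lb_ratfuns n" "f + g \<in> lb_ratfuns n"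
      using that sub by (auto intro: lb_ratfuns_add)
    show ?thesis
    proof (cases "f = 0 \<or> g = 0 \<or> f + g = 0")
      case True
      then show ?thesis using that zero_in_lex_prime by auto
    next
      case False
      then have fg: "f \<noteq> 0" "g \<noteq> 0" by auto
      obtain p q where p: "p \<in> polys n" "q \<in> polys n" "p \<noteq> 0" "q \<noteq> 0" "f = Fract p q"
        "lowest_monomial q \<le> lowest_monomial p"
        "\<forall>k. f \<in> lex_prime n k \<longleftrightarrow> initial_part k (lowest_monomial q) < initial_part k (lowest_monomial p)"
        using lb(1) fg(1) by (rule nonzero_lb_ratfun_cases)
      have pk: "initial_part k (lowest_monomial q) < initial_part k (lowest_monomial p)"
        using p(7) that(1) by blast
      obtain r s where r: "r \<in> polys n" "s \<in> polys n" "r \<noteq> 0" "s \<noteq> 0" "g = Fract r s"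
        "lowest_monomial s \<le> lowest_monomial r"
        "\<forall>k. g \<in> lex_prime n k \<longleftrightarrow> initial_part k (lowest_monomial s) < initial_part k (lowest_monomial r)"
        using lb(2) fg(2) by (rule nonzero_lb_ratfun_cases)
      have rk: "initial_part k (lowest_monomial s) < initial_part k (lowest_monomial r)"
        using r(7) that(2) by blast
      have sum: "f + g = Fract (p * s + r * q) (q * s)" using p(4,5) r(4,5) by simp
      have nz: "p * s + r * q \<noteq> 0" using False sum by (auto simp: fract_collapse)
      have in_p: "initial_part k (lowest_monomial (q * s)) < initial_part k m"
        if "m \<in> Poly_Mapping.keys (p * s)" for m
      proof -
        have "initial_part k (lowest_monomial (q * s)) < initial_part k (lowest_monomial (p * s))"
          using p(3,4) r(4) pk by (simp add: lowest_monomial_mult initial_part_add)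
        also have "\<dots> \<le> initial_part k m" using that by (intro initial_part_mono) simp
        finally show ?thesis .
      qed
      have in_r: "initial_part k (lowest_monomial (q * s)) < initial_part k m"
        if "m \<in> Poly_Mapping.keys (r * q)" for m
      proof -
        have "initial_part k (lowest_monomial (q * s)) < initial_part k (lowest_monomial (r * q))"
          using p(4) r(3,4) rk by (simp add: lowest_monomial_mult initial_part_add add.commute)
        also have "\<dots> \<le> initial_part k m" using that by (intro initial_part_mono) simp
        finally show ?thesis .
      qed
      have "initial_part k (lowest_monomial (q * s)) < initial_part k (lowest_monomial (p * s + r * q))"
        using lowest_monomial_add[OF nz] in_p in_r by blast
      then show ?thesis
        unfolding sum using p(1-4) r(1-4) nz lb(3) sum
        by (subst Fract_in_lex_prime_iff) (auto intro: polys_add polys_mult)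
    qed
  qed
  have mult: "g * f \<in> lex_prime n k" if "f \<in> lex_prime n k" "g \<in> lb_ratfuns n" for f g :: "'r ratfun"
  proof -
    have lb: "f \<in> lb_ratfuns n" "g * f \<in> lb_ratfuns n" "g \<in> lb_ratfuns n"
      using that sub by (auto intro: lb_ratfuns_mult)
    show ?thesis
    proof (cases "f = 0 \<or> g = 0")
      case True
      then show ?thesis using zero_in_lex_prime by auto
    next
      case False
      then have fg: "f \<noteq> 0" "g \<noteq> 0" by auto
      obtain p q where p: "p \<in> polys n" "q \<in> polys n" "p \<noteq> 0" "q \<noteq> 0" "f = Fract p q"
        "lowest_monomial q \<le> lowest_monomial p"
        "\<forall>k. f \<in> lex_prime n k \<longleftrightarrow> initial_part k (lowest_monomial q) < initial_part k (lowest_monomial p)"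
        using lb(1) fg(1) by (rule nonzero_lb_ratfun_cases)
      have pk: "initial_part k (lowest_monomial q) < initial_part k (lowest_monomial p)"
        using p(7) that(1) by blast
      obtain r s where r: "r \<in> polys n" "s \<in> polys n" "r \<noteq> 0" "s \<noteq> 0" "g = Fract r s"
        "lowest_monomial s \<le> lowest_monomial r"
        "\<forall>k. g \<in> lex_prime n k \<longleftrightarrow> initial_part k (lowest_monomial s) < initial_part k (lowest_monomial r)"
        using lb(3) fg(2) by (rule nonzero_lb_ratfun_cases)
      have "initial_part k (lowest_monomial (s * q)) < initial_part k (lowest_monomial (r * p))"
        using p(3,4) r(3,4) pk initial_part_mono[OF r(6), of k]
        by (simp add: lowest_monomial_mult initial_part_add add_le_less_mono)
      moreover have "g * f = Fract (r * p) (s * q)" using p(5) r(5) by simp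
      ultimately show ?thesis
        using p(1-4) r(1-4) lb(2) by (subst \<open>g * f = _\<close>, subst Fract_in_lex_prime_iff) (auto intro: polys_mult)
    qed
  qed
  have prime: "f \<in> lex_prime n k \<or> g \<in> lex_prime n k"
    if "f \<in> lb_ratfuns n" "g \<in> lb_ratfuns n" "f * g \<in> lex_prime n k" for f g :: "'r ratfun"
  proof (cases "f = 0 \<or> g = 0")
    case True
    then show ?thesis using zero_in_lex_prime by auto
  next
    case False
    then have fg: "f \<noteq> 0" "g \<noteq> 0" by auto
    note lb = that(1,2)
    obtain p q where p: "p \<in> polys n" "q \<in> polys n" "p \<noteq> 0" "q \<noteq> 0" "f = Fract p q"
      "lowest_monomial q \<le> lowest_monomial p"
      "\<forall>k. f \<in> lex_prime n k \<longleftrightarrow> initial_part k (lowest_monomial q) < initial_part k (lowest_monomial p)"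
      using lb(1) fg(1) by (rule nonzero_lb_ratfun_cases)
    obtain r s where r: "r \<in> polys n" "s \<in> polys n" "r \<noteq> 0" "s \<noteq> 0" "g = Fract r s"
      "lowest_monomial s \<le> lowest_monomial r"
      "\<forall>k. g \<in> lex_prime n k \<longleftrightarrow> initial_part k (lowest_monomial s) < initial_part k (lowest_monomial r)"
      using lb(2) fg(2) by (rule nonzero_lb_ratfun_cases)
    have "Fract (p * r) (q * s) \<in> lex_prime n k" using that(3) p(5) r(5) by simp
    then have "initial_part k (lowest_monomial (q * s)) < initial_part k (lowest_monomial (p * r))"
      using Fract_in_lex_prime_iff[of "p * r" n "q * s" k] p(1-4) r(1-4) polys_mult sub
      by (metis (no_types) mult_eq_0_iff subsetD)
    then have "initial_part k (lowest_monomial q) + initial_part k (lowest_monomial s)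
        < initial_part k (lowest_monomial p) + initial_part k (lowest_monomial r)"
      using p(3,4) r(3,4) by (simp add: lowest_monomial_mult initial_part_add)
    then show ?thesis
      unfolding p(7)[rule_format] r(7)[rule_format] by (meson add_mono not_less)
  qed
  show ?thesis
    unfolding prime_ideal_of_def
    by (intro conjI ballI impI) (simp_all add: sub zero_in_lex_prime one add mult prime)
qed

lemma lex_prime_strict_chain:
  assumes "k < n"
  shows "lex_prime n k \<subset> (lex_prime n (Suc k) :: 'r::linordered_field ratfun set)"
proof
  show "lex_prime n k \<subseteq> (lex_prime n (Suc k) :: 'r ratfun set)"
  proof
    fix f :: "'r ratfun"
    assume f: "f \<in> lex_prime n k"
    then have "f \<in> lb_ratfuns n" by (simp add: lex_prime_def)
    show "f \<in> lex_prime n (Suc k)"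
    proof (cases "f = 0")
      case True
      then show ?thesis by (simp add: zero_in_lex_prime)
    next
      case False
      with \<open>f \<in> lb_ratfuns n\<close> obtain p q where pq: "p \<in> polys n" "q \<in> polys n" "p \<noteq> 0" "q \<noteq> 0"
        "f = Fract p q" "lowest_monomial q \<le> lowest_monomial p"
        "\<forall>k. f \<in> lex_prime n k \<longleftrightarrow> initial_part k (lowest_monomial q) < initial_part k (lowest_monomial p)"
        by (rule nonzero_lb_ratfun_cases)
      have "\<not> initial_part (Suc k) (lowest_monomial p) \<le> initial_part (Suc k) (lowest_monomial q)"
        using pq(7)[rule_format, of k] f initial_part_mono[of _ _ k] initial_part_initial_part[of k "Suc k"]
        by (metis le_SucI order_refl not_less)
      then show ?thesis using pq(7) by simp
    qed
  qed
  \<comment> \<open>The inclusion is strict because the variable \<open>k\<close> has value \<open>1\<close> at position \<open>k\<close> and \<open>0\<close> before it.\<close>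
  let ?m = "Poly_Mapping.single k (1 :: nat)"
  let ?x = "Poly_Mapping.single ?m (1 :: 'r)"
  have x: "?x \<in> polys n" by (rule polys_single) (use assms in auto)
  have nz: "?x \<noteq> 0" by (metis lookup_single_eq lookup_zero zero_neq_one)
  have low: "lowest_monomial ?x = ?m" "lowest_monomial (1 :: 'r mpolynomial) = 0"
    by (simp_all add: lowest_monomial_single)
  have iff: "Fract ?x 1 \<in> lex_prime n j \<longleftrightarrow> initial_part j 0 < initial_part j ?m" for j
    using Fract_in_lex_prime_iff[OF x polys_one nz] polynomial_in_lb_ratfuns[OF x] low by simp
  have "initial_part k ?m = initial_part k 0"
    by (rule poly_mapping_eqI) (simp add: lookup_initial_part lookup_single)
  then have "Fract ?x 1 \<notin> lex_prime n k" by (simp only: iff order.irrefl not_False_eq_True)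
  moreover have "initial_part (Suc k) 0 < initial_part (Suc k) ?m"
    by (auto simp: less_poly_mapping.rep_eq less_fun_def lookup_initial_part lookup_single intro!: exI[of _ k])
  then have "Fract ?x 1 \<in> lex_prime n (Suc k)" by (simp only: iff)
  ultimately show "lex_prime n k \<noteq> (lex_prime n (Suc k) :: 'r ratfun set)" by blast
qed

section \<open>Chains of primes and algebraic independence\<close>

lemma closed_subring_sum:
  "closed_subring A \<Longrightarrow> (\<And>x. x \<in> S \<Longrightarrow> f x \<in> A) \<Longrightarrow> sum f S \<in> A"
  by (induction S rule: infinite_finite_induct) (auto simp: closed_subring_def)

lemma closed_subring_prod:
  "closed_subring A \<Longrightarrow> (\<And>x. x \<in> S \<Longrightarrow> f x \<in> A) \<Longrightarrow> prod f S \<in> A"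
  by (induction S rule: infinite_finite_induct) (auto simp: closed_subring_def)

lemma closed_subring_power: "closed_subring A \<Longrightarrow> x \<in> A \<Longrightarrow> x ^ k \<in> A"
  by (induction k) (auto simp: closed_subring_def)

lemma prime_ideal_power:
  "closed_subring A \<Longrightarrow> prime_ideal_of A P \<Longrightarrow> x \<in> A \<Longrightarrow> x ^ k \<in> P \<Longrightarrow> x \<in> P"
proof (induction k)
  case (Suc k)
  then have "x * x ^ k \<in> P" "x ^ k \<in> A" using closed_subring_power by auto
  then have "x \<in> P \<or> x ^ k \<in> P" using Suc.prems(2,3) unfolding prime_ideal_of_def by blast
  then show ?case using Suc by blast
qed (simp add: prime_ideal_of_def)

lemma prime_ideal_diff:
  assumes "closed_subring A" "prime_ideal_of A P" "x + y \<in> P" "y \<in> P"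
  shows "x \<in> P"
proof -
  have "(- 1) * y \<in> P" using assms unfolding prime_ideal_of_def closed_subring_def by blast
  then have "(x + y) + (- 1) * y \<in> P" using assms unfolding prime_ideal_of_def by blast
  then show ?thesis by simp
qed

text \<open>Elements that witness the strictness of a chain of primes satisfy no polynomial relation.
  From a relation modulo \<open>P j\<close>, divide by the largest common power of \<open>a j\<close>, which is
  allowed as \<open>a j \<notin> P j\<close>. Modulo \<open>P (Suc j)\<close>, which contains \<open>a j\<close>,
  only the terms without \<open>a j\<close> survive, and they form a relation in fewer elements. At the
  end of the chain a unit would lie in \<open>P m\<close>. The set \<open>S\<close> lists the exponent vectors of
  the relation; they differ on \<open>{j..<m}\<close>, so they stand for distinct monomials.\<close>

lemma prime_chain_independent:
  fixes a :: "nat \<Rightarrow> 'k::field"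
  assumes A: "closed_subring A" and P: "\<And>i. i \<le> m \<Longrightarrow> prime_ideal_of A (P i)"
    and chain: "\<And>i. i < m \<Longrightarrow> P i \<subseteq> P (Suc i)"
    and a: "\<And>i. i < m \<Longrightarrow> a i \<in> P (Suc i)" "\<And>i. i < m \<Longrightarrow> a i \<notin> P i"
    and "j \<le> m" and S: "finite S" "S \<noteq> {}"
    and distinct: "\<forall>\<alpha>\<in>S. \<forall>\<beta>\<in>S. (\<forall>i\<in>{j..<m}. \<alpha> i = \<beta> i) \<longrightarrow> \<alpha> = \<beta>"
    and c: "\<forall>\<alpha>\<in>S. c \<alpha> \<in> A \<and> c \<alpha> \<noteq> 0 \<and> inverse (c \<alpha>) \<in> A"
  shows "(\<Sum>\<alpha>\<in>S. c \<alpha> * (\<Prod>i=j..<m. a i ^ \<alpha> i)) \<notin> P j"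
  using \<open>j \<le> m\<close> S distinct c
proof (induction arbitrary: S rule: inc_induct)
  case base
  then obtain \<alpha> where S: "S = {\<alpha>}" by (metis atLeastLessThan_empty equals0D is_singletonI' is_singletonE order_refl)
  have "c \<alpha> \<notin> P m"
  proof
    assume "c \<alpha> \<in> P m"
    moreover have "inverse (c \<alpha>) \<in> A" using base S by simp
    ultimately have "inverse (c \<alpha>) * c \<alpha> \<in> P m"
      using P[of m] unfolding prime_ideal_of_def by blast
    moreover have "c \<alpha> \<noteq> 0" using base S by simp
    ultimately show False using P[of m] by (simp add: prime_ideal_of_def)
  qed
  then show ?case by (simp add: S)
next
  case (step j)
  have Pj: "prime_ideal_of A (P j)" "prime_ideal_of A (P (Suc j))" using P step.hyps by auto
  have aA: "a i \<in> A" if "i < m" for i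
    using a(1)[OF that] P[of "Suc i"] that by (auto simp: prime_ideal_of_def)
  define e where "e = Min ((\<lambda>\<alpha>. \<alpha> j) ` S)"
  define S0 where "S0 = {\<alpha> \<in> S. \<alpha> j = e}"
  define T where "T \<alpha> = c \<alpha> * (\<Prod>i=Suc j..<m. a i ^ \<alpha> i)" for \<alpha>
  have e_le: "e \<le> \<alpha> j" if "\<alpha> \<in> S" for \<alpha> using that step.prems(1) by (simp add: e_def)
  have "e \<in> (\<lambda>\<alpha>. \<alpha> j) ` S" unfolding e_def using step.prems by (intro Min_in) auto
  then have S0: "S0 \<noteq> {}" "finite S0" "S0 \<subseteq> S" using step.prems(1) by (auto simp: S0_def)
  have TA: "T \<alpha> \<in> A" if "\<alpha> \<in> S" for \<alpha>
  proof -
    have "(\<Prod>i=Suc j..<m. a i ^ \<alpha> i) \<in> A"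
      using aA by (intro closed_subring_prod closed_subring_power A) auto
    then show ?thesis using that step.prems(4) A by (auto simp: T_def closed_subring_def)
  qed
  define F where "F = (\<Sum>\<alpha>\<in>S. T \<alpha> * a j ^ (\<alpha> j - e))"
  define G where "G = (\<Sum>\<alpha>\<in>S - S0. T \<alpha> * a j ^ (\<alpha> j - e - 1))"
  have FA: "F \<in> A" and GA: "G \<in> A"
    unfolding F_def G_def using TA closed_subring_power[OF A aA[OF step.hyps(2)]] A
    by (auto intro!: closed_subring_sum simp: closed_subring_def)
  have "(\<Sum>\<alpha>\<in>S. c \<alpha> * (\<Prod>i=j..<m. a i ^ \<alpha> i)) = a j ^ e * F"
    unfolding F_def sum_distrib_left
  proof (rule sum.cong)
    fix \<alpha>
    assume "\<alpha> \<in> S"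
    then have "a j ^ \<alpha> j = a j ^ e * a j ^ (\<alpha> j - e)"
      using e_le[of \<alpha>] by (simp flip: power_add)
    then show "c \<alpha> * (\<Prod>i=j..<m. a i ^ \<alpha> i) = a j ^ e * (T \<alpha> * a j ^ (\<alpha> j - e))"
      using step.hyps by (simp add: T_def prod.atLeast_Suc_lessThan mult_ac)
  qed simp
  moreover have F_split: "F = (\<Sum>\<alpha>\<in>S0. T \<alpha>) + G * a j"
  proof -
    have "F = (\<Sum>\<alpha>\<in>S0. T \<alpha> * a j ^ (\<alpha> j - e)) + (\<Sum>\<alpha>\<in>S - S0. T \<alpha> * a j ^ (\<alpha> j - e))"
      unfolding F_def using sum.subset_diff[OF S0(3) step.prems(1)] by (simp only: add.commute)
    moreover have "(\<Sum>\<alpha>\<in>S0. T \<alpha> * a j ^ (\<alpha> j - e)) = (\<Sum>\<alpha>\<in>S0. T \<alpha>)"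
      by (intro sum.cong) (auto simp: S0_def)
    moreover have "(\<Sum>\<alpha>\<in>S - S0. T \<alpha> * a j ^ (\<alpha> j - e)) = G * a j"
      unfolding G_def sum_distrib_right
    proof (rule sum.cong)
      fix \<alpha>
      assume "\<alpha> \<in> S - S0"
      then have "e < \<alpha> j" using e_le[of \<alpha>] by (auto simp: S0_def)
      then have "\<alpha> j - e = Suc (\<alpha> j - e - 1)" by simp
      then have "a j ^ (\<alpha> j - e) = a j ^ (\<alpha> j - e - 1) * a j" by (metis power_Suc2)
      then show "T \<alpha> * a j ^ (\<alpha> j - e) = T \<alpha> * a j ^ (\<alpha> j - e - 1) * a j"
        by (simp only: mult.assoc)
    qed simp
    ultimately show ?thesis by simp
  qed
  moreover have "(\<Sum>\<alpha>\<in>S0. T \<alpha>) \<notin> P (Suc j)"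
    unfolding T_def
  proof (rule step.IH[OF S0(2,1)])
    have "\<alpha> = \<beta>" if "\<alpha> \<in> S0" "\<beta> \<in> S0" "\<forall>i\<in>{Suc j..<m}. \<alpha> i = \<beta> i" for \<alpha> \<beta>
    proof -
      have "\<alpha> i = \<beta> i" if "i \<in> {j..<m}" for i
        using that \<open>\<alpha> \<in> S0\<close> \<open>\<beta> \<in> S0\<close> \<open>\<forall>i\<in>{Suc j..<m}. \<alpha> i = \<beta> i\<close>
        by (cases "i = j") (auto simp: S0_def)
      then show ?thesis using step.prems(3) that(1,2) S0(3) by blast
    qed
    then show "\<forall>\<alpha>\<in>S0. \<forall>\<beta>\<in>S0. (\<forall>i\<in>{Suc j..<m}. \<alpha> i = \<beta> i) \<longrightarrow> \<alpha> = \<beta>" by blast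
    show "\<forall>\<alpha>\<in>S0. c \<alpha> \<in> A \<and> c \<alpha> \<noteq> 0 \<and> inverse (c \<alpha>) \<in> A" using step.prems(4) S0(3) by blast
  qed
  moreover have "a j ^ e * F \<notin> P j"
  proof
    assume "a j ^ e * F \<in> P j"
    moreover have "a j ^ e \<in> A" "a j ^ e \<notin> P j"
      using prime_ideal_power[OF A Pj(1)] closed_subring_power[OF A] aA a(2) step.hyps(2) by blast+
    ultimately have "F \<in> P j" using FA Pj(1) unfolding prime_ideal_of_def by blast
    then have "(\<Sum>\<alpha>\<in>S0. T \<alpha>) + G * a j \<in> P (Suc j)" using chain[OF step.hyps(2)] F_split by auto
    moreover have "G * a j \<in> P (Suc j)"
      using GA a(1)[OF step.hyps(2)] Pj(2) unfolding prime_ideal_of_def by blast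
    ultimately have "(\<Sum>\<alpha>\<in>S0. T \<alpha>) \<in> P (Suc j)" by (rule prime_ideal_diff[OF A Pj(2)])
    with \<open>(\<Sum>\<alpha>\<in>S0. T \<alpha>) \<notin> P (Suc j)\<close> show False by blast
  qed
  ultimately show ?case by simp
qed

section \<open>Counting monomials\<close>

text \<open>Each exponent is bounded separately, rather than the total degree, so that the count is a
  plain power.\<close>

definition exponent_box :: "nat \<Rightarrow> nat \<Rightarrow> (nat \<Rightarrow>\<^sub>0 nat) set" where
  "exponent_box n d = {m. Poly_Mapping.keys m \<subseteq> {..<n} \<and> (\<forall>i. Poly_Mapping.lookup m i \<le> d)}"

lemma card_exponent_box: "finite (exponent_box n d)" "card (exponent_box n d) \<le> Suc d ^ n"
proof -
  let ?f = "\<lambda>m. restrict (Poly_Mapping.lookup m) {..<n}"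
  have inj: "inj_on ?f (exponent_box n d)"
  proof (rule inj_onI)
    fix m m'
    assume m: "m \<in> exponent_box n d" "m' \<in> exponent_box n d" and eq: "?f m = ?f m'"
    show "m = m'"
    proof (rule poly_mapping_eqI)
      fix i
      show "Poly_Mapping.lookup m i = Poly_Mapping.lookup m' i"
      proof (cases "i < n")
        case True
        then show ?thesis using fun_cong[OF eq, of i] by simp
      next
        case False
        then have "i \<notin> Poly_Mapping.keys m" "i \<notin> Poly_Mapping.keys m'"
          using m by (auto simp: exponent_box_def)
        then show ?thesis by (simp add: in_keys_iff)
      qed
    qed
  qed
  have sub: "?f ` exponent_box n d \<subseteq> PiE {..<n} (\<lambda>_. {..d})"
    by (rule image_subsetI) (simp add: exponent_box_def restrict_PiE_iff)
  have fin: "finite (PiE {..<n} (\<lambda>_. {..d}))" by (intro finite_PiE) auto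
  show "finite (exponent_box n d)" using inj_on_finite[OF inj sub fin] .
  show "card (exponent_box n d) \<le> Suc d ^ n"
    using card_inj_on_le[OF inj sub fin] by (simp add: card_PiE)
qed

definition box_polys :: "nat \<Rightarrow> nat \<Rightarrow> 'r::zero mpolynomial set" where
  "box_polys n d = {p. Poly_Mapping.keys p \<subseteq> exponent_box n d}"

lemma box_polys_mono: "d \<le> e \<Longrightarrow> box_polys n d \<subseteq> box_polys n e"
  unfolding box_polys_def exponent_box_def by (auto intro: order_trans)

lemma polys_imp_box_polys:
  assumes "p \<in> polys n"
  shows "\<exists>d. p \<in> box_polys n d"
proof -
  let ?d = "\<Sum>m\<in>Poly_Mapping.keys p. \<Sum>i\<in>Poly_Mapping.keys m. Poly_Mapping.lookup m i"
  have "Poly_Mapping.lookup m i \<le> ?d" if "m \<in> Poly_Mapping.keys p" for m i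
  proof (cases "i \<in> Poly_Mapping.keys m")
    case True
    then have "Poly_Mapping.lookup m i \<le> (\<Sum>i\<in>Poly_Mapping.keys m. Poly_Mapping.lookup m i)"
      by (intro member_le_sum) auto
    also have "\<dots> \<le> ?d" using that by (intro member_le_sum) auto
    finally show ?thesis .
  qed (simp add: in_keys_iff)
  then show ?thesis
    using assms by (intro exI[of _ ?d]) (auto simp: box_polys_def exponent_box_def polys_def)
qed

lemma box_polys_one: "(1 :: 'r::comm_ring_1 mpolynomial) \<in> box_polys n d"
  by (simp add: box_polys_def exponent_box_def)

lemma box_polys_mult:
  fixes p q :: "'r::comm_ring_1 mpolynomial"
  assumes "p \<in> box_polys n d" "q \<in> box_polys n e"
  shows "p * q \<in> box_polys n (d + e)"
proof -
  have "m \<in> exponent_box n (d + e)" if "m \<in> Poly_Mapping.keys (p * q)" for m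
  proof -
    obtain a b where ab: "m = a + b" "a \<in> Poly_Mapping.keys p" "b \<in> Poly_Mapping.keys q"
      using \<open>m \<in> Poly_Mapping.keys (p * q)\<close> by (rule keys_mult_imp)
    then have "a \<in> exponent_box n d" "b \<in> exponent_box n e"
      using assms by (auto simp: box_polys_def)
    then show ?thesis
      using Poly_Mapping.keys_add[of a b] unfolding ab(1) exponent_box_def
      by (auto simp: lookup_add intro: add_mono)
  qed
  then show ?thesis by (auto simp: box_polys_def)
qed

lemma box_polys_power:
  fixes p :: "'r::comm_ring_1 mpolynomial"
  shows "p \<in> box_polys n d \<Longrightarrow> p ^ k \<in> box_polys n (k * d)"
  by (induction k) (auto intro: box_polys_one box_polys_mult)

lemma box_polys_prod:
  fixes p :: "'i \<Rightarrow> 'r::comm_ring_1 mpolynomial"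
  shows "(\<And>i. i \<in> I \<Longrightarrow> p i \<in> box_polys n (d i)) \<Longrightarrow> prod p I \<in> box_polys n (sum d I)"
  by (induction I rule: infinite_finite_induct) (auto intro: box_polys_one box_polys_mult)

lemma polys_prod:
  fixes p :: "'i \<Rightarrow> 'r::comm_ring_1 mpolynomial"
  shows "(\<And>i. i \<in> I \<Longrightarrow> p i \<in> polys n) \<Longrightarrow> prod p I \<in> polys n"
  by (induction I rule: infinite_finite_induct) (auto intro: polys_one polys_mult)

lemma common_denominator:
  fixes a :: "nat \<Rightarrow> 'r::linordered_field ratfun"
  assumes "\<And>i. i < m \<Longrightarrow> a i \<in> ratfuns n"
  obtains p q where "\<forall>i<m. p i \<in> polys n" "q \<in> polys n" "q \<noteq> 0" "\<forall>i<m. a i = Fract (p i) q"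
proof -
  have "\<forall>i. \<exists>r s. i < m \<longrightarrow> r \<in> polys n \<and> s \<in> polys n \<and> s \<noteq> 0 \<and> a i = Fract r s"
    using assms unfolding ratfuns_def by blast
  then obtain r s where rs: "i < m \<Longrightarrow> r i \<in> polys n" "i < m \<Longrightarrow> s i \<in> polys n"
    "i < m \<Longrightarrow> s i \<noteq> 0" "i < m \<Longrightarrow> a i = Fract (r i) (s i)" for i
    by metis
  show ?thesis
  proof (rule that[of "\<lambda>i. r i * (\<Prod>j\<in>{..<m} - {i}. s j)" "\<Prod>j<m. s j"])
    show "\<forall>i<m. r i * (\<Prod>j\<in>{..<m} - {i}. s j) \<in> polys n" "(\<Prod>j<m. s j) \<in> polys n"
      using rs by (auto intro!: polys_mult polys_prod)
    show nz: "(\<Prod>j<m. s j) \<noteq> 0" using rs(3) by simp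
    show "\<forall>i<m. a i = Fract (r i * (\<Prod>j\<in>{..<m} - {i}. s j)) (\<Prod>j<m. s j)"
    proof (intro allI impI)
      fix i
      assume i: "i < m"
      have "(\<Prod>j<m. s j) = s i * (\<Prod>j\<in>{..<m} - {i}. s j)"
        using i by (intro prod.remove) auto
      then show "a i = Fract (r i * (\<Prod>j\<in>{..<m} - {i}. s j)) (\<Prod>j<m. s j)"
        using nz rs(3,4)[OF i] by (simp add: eq_fract mult_ac)
    qed
  qed
qed

lemma Fract_power: "Fract p q ^ k = Fract (p ^ k) (q ^ k)"
  by (induction k) (simp_all add: One_fract_def)

lemma Fract_prod: "(\<Prod>i\<in>I. Fract (p i) (q i)) = Fract (\<Prod>i\<in>I. p i) (\<Prod>i\<in>I. q i)"
  by (induction I rule: infinite_finite_induct) (auto simp: One_fract_def)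

lemma Fract_sum:
  assumes "q \<noteq> 0"
  shows "Fract (\<Sum>i\<in>I. p i) q = (\<Sum>i\<in>I. Fract (p i) q)"
proof (induction I rule: infinite_finite_induct)
  case (insert i I)
  have "Fract (\<Sum>i\<in>insert i I. p i) q = Fract (p i + (\<Sum>i\<in>I. p i)) q"
    using insert.hyps by simp
  also have "\<dots> = Fract (p i) q + Fract (\<Sum>i\<in>I. p i) q"
    using assms by (simp add: eq_fract algebra_simps)
  also have "\<dots> = (\<Sum>i\<in>insert i I. Fract (p i) q)"
    using insert.hyps by (simp only: insert.IH sum.insert not_False_eq_True)
  finally show ?case .
qed (simp_all add: fract_collapse)

text \<open>The right-hand side is at most \<open>D\<^sup>n (k + 1)\<^sup>n\<close>, so for \<open>m > n\<close>
  the inequality fails at \<open>D = (k + 1)\<^sup>n + 1\<close>.\<close>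

lemma power_growth_bound:
  assumes "\<And>D. D ^ m \<le> Suc (D * k) ^ n"
  shows "m \<le> n"
proof (rule ccontr)
  assume "\<not> m \<le> n"
  define D where "D = Suc (Suc k ^ n)"
  have "D ^ n * D = D ^ Suc n" by simp
  also have "\<dots> \<le> D ^ m"
    using \<open>\<not> m \<le> n\<close> by (intro power_increasing) (auto simp: D_def)
  also have "\<dots> \<le> Suc (D * k) ^ n" by (rule assms)
  also have "\<dots> \<le> (D * Suc k) ^ n" by (intro power_mono) (auto simp: D_def)
  also have "\<dots> = D ^ n * Suc k ^ n" by (rule power_mult_distrib)
  finally have "D \<le> Suc k ^ n" by (simp add: D_def)
  then show False by (simp add: D_def)
qed

lemma vector_space_ratfun:
  "vector_space (\<lambda>c f. const_ratfun c * f :: 'r::linordered_field ratfun)"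
  by unfold_locales (simp_all add: const_ratfun_simps algebra_simps)

text \<open>The transcendence degree bound by counting. Over a common denominator \<open>q\<close>, the
  \<open>D\<^sup>m\<close> monomials in the \<open>a i\<close> with exponents below \<open>D\<close> are polynomials
  divided by \<open>q\<^bsup>m D\<^esup>\<close> whose exponents grow linearly in \<open>D\<close>, so they lie
  in a space whose dimension is at most of order \<open>D\<^sup>n\<close>. They are linearly independent,
  so \<open>D\<^sup>m\<close> cannot outgrow \<open>D\<^sup>n\<close>.\<close>

lemma algebraically_independent_le:
  fixes a :: "nat \<Rightarrow> 'r::linordered_field ratfun"
  assumes a: "\<And>i. i < m \<Longrightarrow> a i \<in> ratfuns n"
    and indep: "\<And>S c. finite S \<Longrightarrow> S \<noteq> {} \<Longrightarrow> S \<subseteq> PiE {..<m} (\<lambda>_. UNIV) \<Longrightarrow> \<forall>\<alpha>\<in>S. c \<alpha> \<noteq> 0 \<Longrightarrow>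
      (\<Sum>\<alpha>\<in>S. const_ratfun (c \<alpha>) * (\<Prod>i<m. a i ^ \<alpha> i)) \<noteq> 0"
  shows "m \<le> n"
proof -
  interpret vector_space "\<lambda>c f. const_ratfun c * f :: 'r ratfun" by (rule vector_space_ratfun)
  obtain p q where pq: "\<forall>i<m. p i \<in> polys n" "q \<in> polys n" "q \<noteq> 0" "\<forall>i<m. a i = Fract (p i) q"
    using common_denominator[of m a n] a by blast
  have "\<exists>e. (\<forall>i<m. p i \<in> box_polys n e) \<and> q \<in> box_polys n e"
  proof -
    have "\<forall>i. \<exists>d. i < m \<longrightarrow> p i \<in> box_polys n d"
      using polys_imp_box_polys pq(1) by blast
    then obtain d where d: "\<forall>i<m. p i \<in> box_polys n (d i)"
      unfolding choice_iff by blast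
    obtain d' where d': "q \<in> box_polys n d'" using polys_imp_box_polys[OF pq(2)] by blast
    have "d i \<le> (\<Sum>i<m. d i) + d'" if "i < m" for i
      using member_le_sum[of i "{..<m}" d] that by simp
    then have "p i \<in> box_polys n ((\<Sum>i<m. d i) + d')" if "i < m" for i
      using d box_polys_mono[of "d i" "(\<Sum>i<m. d i) + d'" n] that by blast
    moreover have "q \<in> box_polys n ((\<Sum>i<m. d i) + d')"
      using d' box_polys_mono[of d' "(\<Sum>i<m. d i) + d'" n] by auto
    ultimately show ?thesis by blast
  qed
  then obtain e where e: "\<And>i. i < m \<Longrightarrow> p i \<in> box_polys n e" "q \<in> box_polys n e" by blast
  define b where "b \<alpha> = (\<Prod>i<m. a i ^ \<alpha> i)" for \<alpha> :: "nat \<Rightarrow> nat"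
  have "D ^ m \<le> Suc (D * (m * e)) ^ n" for D
  proof -
    define E where "E = PiE {..<m} (\<lambda>_. {..<D})"
    define L where "L = m * D"
    define T where "T = (\<lambda>\<mu>. Fract (Poly_Mapping.single \<mu> (1 :: 'r)) (q ^ L)) ` exponent_box n (L * e)"
    have finE: "finite E" unfolding E_def by (intro finite_PiE) auto
    have E_sub: "E \<subseteq> PiE {..<m} (\<lambda>_. UNIV)" unfolding E_def by (intro PiE_mono) auto
    \<comment> \<open>Independence is a statement about families; as a set, the monomials are distinct because two
      equal ones would satisfy a relation with coefficients \<open>1\<close> and \<open>- 1\<close>.\<close>
    have inj: "inj_on b E"
    proof (rule inj_onI, rule ccontr)
      fix \<alpha> \<beta>
      assume \<alpha>\<beta>: "\<alpha> \<in> E" "\<beta> \<in> E" "b \<alpha> = b \<beta>" "\<alpha> \<noteq> \<beta>"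
      have "(\<Sum>\<gamma>\<in>{\<alpha>, \<beta>}. const_ratfun (if \<gamma> = \<alpha> then 1 else - 1) * (\<Prod>i<m. a i ^ \<gamma> i)) \<noteq> 0"
        using \<alpha>\<beta> E_sub by (intro indep) auto
      then show False
        using \<alpha>\<beta>(3,4) by (auto simp: const_ratfun_simps b_def)
    qed
    have "independent (b ` E)"
    proof
      assume "dependent (b ` E)"
      then obtain B u where B: "finite B" "B \<subseteq> b ` E" "(\<Sum>v\<in>B. const_ratfun (u v) * v) = 0"
        "\<exists>v\<in>B. u v \<noteq> 0"
        unfolding dependent_explicit by blast
      define S where "S = {\<alpha> \<in> E. b \<alpha> \<in> B \<and> u (b \<alpha>) \<noteq> 0}"
      have image: "b ` S = {v \<in> B. u v \<noteq> 0}" using B(2) by (auto simp: S_def)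
      have "(\<Sum>\<alpha>\<in>S. const_ratfun (u (b \<alpha>)) * b \<alpha>) = (\<Sum>v\<in>b ` S. const_ratfun (u v) * v)"
        by (rule sum.reindex_cong[symmetric, of b])
           (use inj in \<open>auto simp: S_def intro: inj_on_subset\<close>)
      also have "\<dots> = (\<Sum>v\<in>B. const_ratfun (u v) * v)"
        unfolding image using B(1)
        by (intro sum.mono_neutral_left) (auto simp: const_ratfun_simps)
      finally have "(\<Sum>\<alpha>\<in>S. const_ratfun (u (b \<alpha>)) * b \<alpha>) = 0" using B(3) by simp
      moreover have "finite S" "S \<subseteq> E" using finE by (auto simp: S_def)
      moreover have "S \<noteq> {}" using image B(4) by auto
      moreover have "\<forall>\<alpha>\<in>S. u (b \<alpha>) \<noteq> 0" by (simp add: S_def)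
      ultimately show False using indep[of S "\<lambda>\<alpha>. u (b \<alpha>)"] E_sub by (auto simp: b_def)
    qed
    moreover have "b ` E \<subseteq> span T"
    proof
      fix f
      assume "f \<in> b ` E"
      then obtain \<alpha> where \<alpha>: "\<alpha> \<in> E" "f = b \<alpha>" by blast
      define s where "s = (\<Sum>i<m. \<alpha> i)"
      have "s \<le> (\<Sum>i<m. D)"
        unfolding s_def using \<alpha>(1) by (intro sum_mono) (auto simp: E_def PiE_iff intro: less_imp_le)
      then have "s \<le> L" by (simp add: L_def)
      \<comment> \<open>The spare power of \<open>q\<close> brings monomials of different total degree \<open>s\<close> to the same denominator.\<close>
      define r where "r = (\<Prod>i<m. p i ^ \<alpha> i) * q ^ (L - s)"
      have "f = (\<Prod>i<m. Fract (p i ^ \<alpha> i) (q ^ \<alpha> i))"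
        unfolding \<alpha>(2) b_def using pq(4) by (intro prod.cong) (auto simp: Fract_power)
      also have "\<dots> = Fract (\<Prod>i<m. p i ^ \<alpha> i) (q ^ s)"
        unfolding Fract_prod by (simp add: s_def power_sum)
      also have "\<dots> = Fract r (q ^ L)"
      proof -
        have "q ^ L = q ^ s * q ^ (L - s)" using \<open>s \<le> L\<close> by (simp flip: power_add)
        then show ?thesis using pq(3) by (simp add: r_def eq_fract mult_ac)
      qed
      finally have f: "f = Fract r (q ^ L)" .
      have "r \<in> box_polys n ((\<Sum>i<m. \<alpha> i * e) + (L - s) * e)"
        unfolding r_def using e by (intro box_polys_mult box_polys_prod box_polys_power) auto
      also have "(\<Sum>i<m. \<alpha> i * e) + (L - s) * e = L * e"
        using \<open>s \<le> L\<close> by (simp add: s_def sum_distrib_right[symmetric] add_mult_distrib[symmetric])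
      finally have keys: "Poly_Mapping.keys r \<subseteq> exponent_box n (L * e)" by (simp add: box_polys_def)
      have "f = Fract (\<Sum>\<mu>\<in>Poly_Mapping.keys r. Poly_Mapping.single \<mu> (Poly_Mapping.lookup r \<mu>)) (q ^ L)"
        unfolding f by (subst poly_mapping_sum_single[of r]) (rule refl)
      also have "\<dots> = (\<Sum>\<mu>\<in>Poly_Mapping.keys r. Fract (Poly_Mapping.single \<mu> (Poly_Mapping.lookup r \<mu>)) (q ^ L))"
        using pq(3) by (intro Fract_sum) simp
      also have "\<dots> = (\<Sum>\<mu>\<in>Poly_Mapping.keys r.
          const_ratfun (Poly_Mapping.lookup r \<mu>) * Fract (Poly_Mapping.single \<mu> 1) (q ^ L))"
        by (intro sum.cong) (auto simp: const_ratfun_def mult_single)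
      also have "\<dots> \<in> span T"
        using keys by (intro span_sum span_scale span_base) (auto simp: T_def)
      finally show "f \<in> span T" .
    qed
    moreover have "finite T" unfolding T_def by (intro finite_imageI card_exponent_box)
    ultimately have "card (b ` E) \<le> card T" using independent_span_bound by blast
    also have "card T \<le> Suc (L * e) ^ n"
      unfolding T_def using card_exponent_box card_image_le order_trans by blast
    also have "card (b ` E) = D ^ m" using inj by (simp add: card_image E_def card_PiE)
    finally show ?thesis by (simp add: L_def mult_ac)
  qed
  then show ?thesis by (rule power_growth_bound)
qed

text \<open>The Krull dimension is at most the transcendence degree. The nonzero constants are units of
  the subring, so elements that witness the strict inclusions are independent over them.\<close>

lemma prime_chain_length_le:
  fixes P :: "nat \<Rightarrow> 'r::linordered_field ratfun set"
  assumes A: "closed_subring A" "A \<subseteq> ratfuns n" and const: "\<And>c. const_ratfun c \<in> A"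
    and P: "\<And>i. i \<le> m \<Longrightarrow> prime_ideal_of A (P i)" and chain: "\<And>i. i < m \<Longrightarrow> P i \<subset> P (Suc i)"
  shows "m \<le> n"
proof -
  have "\<forall>i. \<exists>x. i < m \<longrightarrow> x \<in> P (Suc i) \<and> x \<notin> P i" using chain by blast
  then obtain a where a: "i < m \<Longrightarrow> a i \<in> P (Suc i)" "i < m \<Longrightarrow> a i \<notin> P i" for i by metis
  show ?thesis
  proof (rule algebraically_independent_le)
    show "a i \<in> ratfuns n" if "i < m" for i
      using a(1)[OF that] P[of "Suc i"] that A(2) by (auto simp: prime_ideal_of_def)
    fix S :: "(nat \<Rightarrow> nat) set" and c :: "(nat \<Rightarrow> nat) \<Rightarrow> 'r"
    assume S: "finite S" "S \<noteq> {}" "S \<subseteq> PiE {..<m} (\<lambda>_. UNIV)" and c: "\<forall>\<alpha>\<in>S. c \<alpha> \<noteq> 0"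
    have "(\<Sum>\<alpha>\<in>S. const_ratfun (c \<alpha>) * (\<Prod>i=0..<m. a i ^ \<alpha> i)) \<notin> P 0"
    proof (rule prime_chain_independent[where P = P and A = A and m = m])
      show "\<forall>\<alpha>\<in>S. \<forall>\<beta>\<in>S. (\<forall>i\<in>{0..<m}. \<alpha> i = \<beta> i) \<longrightarrow> \<alpha> = \<beta>"
      proof (intro ballI impI)
        fix \<alpha> \<beta>
        assume "\<alpha> \<in> S" "\<beta> \<in> S" and eq: "\<forall>i\<in>{0..<m}. \<alpha> i = \<beta> i"
        then have "\<alpha> \<in> PiE {..<m} (\<lambda>_. UNIV)" "\<beta> \<in> PiE {..<m} (\<lambda>_. UNIV)" using S(3) by auto
        then show "\<alpha> = \<beta>" by (rule PiE_ext) (use eq in auto)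
      qed
      show "prime_ideal_of A (P i)" if "i \<le> m" for i using P[OF that] .
      show "P i \<subseteq> P (Suc i)" if "i < m" for i using chain[OF that] by blast
      show "\<forall>\<alpha>\<in>S. const_ratfun (c \<alpha>) \<in> A \<and> const_ratfun (c \<alpha>) \<noteq> 0 \<and> inverse (const_ratfun (c \<alpha>)) \<in> A"
        using c const by (simp add: const_ratfun_eq_0_iff inverse_const_ratfun)
    qed (use A(1) a S(1,2) in auto)
    moreover have "0 \<in> P 0" using P[of 0] by (simp add: prime_ideal_of_def)
    ultimately show "(\<Sum>\<alpha>\<in>S. const_ratfun (c \<alpha>) * (\<Prod>i<m. a i ^ \<alpha> i)) \<noteq> 0"
      by (auto simp: atLeast0LessThan)
  qed
qed

theorem theorem3p24:
  fixes n :: nat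
  shows "krull_dim (locally_bounded_ring n :: 'r::real_closed_field ratfun ring) = ereal (real n)"
proof -
  let ?A = "lb_ratfuns n :: 'r ratfun set"
  have ring: "locally_bounded_ring n = subring_structure ?A"
    by (simp add: locally_bounded_ring_def lb_ratfuns_def)
  have prime: "primeideal Q (subring_structure ?A) \<longleftrightarrow> prime_ideal_of ?A Q" for Q
    by (rule primeideal_subring_structure_iff[OF closed_subring_lb_ratfuns])
  show ?thesis
    unfolding krull_dim_def ring prime
  proof (rule antisym)
    show "(SUP m\<in>{m. \<exists>P. (\<forall>i\<le>m. prime_ideal_of ?A (P i)) \<and> (\<forall>i<m. P i \<subset> P (Suc i))}. ereal (real m))
        \<le> ereal (real n)"
    proof (rule SUP_least)
      fix m
      assume "m \<in> {m. \<exists>P. (\<forall>i\<le>m. prime_ideal_of ?A (P i)) \<and> (\<forall>i<m. P i \<subset> P (Suc i))}"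
      then obtain P where "\<forall>i\<le>m. prime_ideal_of ?A (P i)" "\<forall>i<m. P i \<subset> P (Suc i)" by blast
      then have "m \<le> n"
        using closed_subring_lb_ratfuns const_in_lb_ratfuns
        by (intro prime_chain_length_le[of ?A n m P]) (simp_all add: lb_ratfuns_subset)
      then show "ereal (real m) \<le> ereal (real n)" by simp
    qed
    show "ereal (real n)
        \<le> (SUP m\<in>{m. \<exists>P. (\<forall>i\<le>m. prime_ideal_of ?A (P i)) \<and> (\<forall>i<m. P i \<subset> P (Suc i))}. ereal (real m))"
    proof (rule SUP_upper)
      have "(\<forall>i\<le>n. prime_ideal_of ?A (lex_prime n i)) \<and> (\<forall>i<n. lex_prime n i \<subset> (lex_prime n (Suc i) :: 'r ratfun set))"
        by (intro conjI allI impI prime_ideal_lex_prime lex_prime_strict_chain)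
      then show "n \<in> {m. \<exists>P. (\<forall>i\<le>m. prime_ideal_of ?A (P i)) \<and> (\<forall>i<m. P i \<subset> P (Suc i))}"
        by (intro CollectI exI[of _ "lex_prime n"])
    qed
  qed
qed

end
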